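(* Let $d \ge 3$ be odd and $k$ a positive integer. Then: (i) $\omega$ is a highest weight vector in $\mathcal{B}_{d,k}(1)$, and every highest weight vector in $\mathcal{B}_{d,k}(1)$ is a scalar multiple of $\omega$. (ii) If $k$ is even and $1 \le n \le k^{d-1}$, then there is a sign $\varepsilon \in \{\pm1\}$ not depending on $T$ such that $$\omega^{n} = \varepsilon \sum_{T} \mathrm{sgn}(T)\, AT_d(k,T)\, \psi_T,$$ where the sum runs over all magic sets $T\subseteq[k]^d$ of cardinality $nk$. In particular, $\omega^{k^{d-1}} = \pm AT_d(k)\, \psi_{[k]^d}$. (iii) If $k$ is odd, then $\omega \wedge \omega = 0$.
   Context: Let $e_1,\ldots,e_k$ be the standard basis of $\mathbb{C}^k$; for $a=(a_1,\ldots,a_d)\in[k]^d$ write $e_a := e_{a_1}\otimes\cdots\otimes e_{a_d}$. Cells of $[k]^d$ are ordered lexicographically. For $P \subseteq [k]^d$ with elements $p_1<\cdots<p_m$, set $\psi_P := e_{p_1}\wedge\cdots\wedge e_{p_m} \in \bigwedge^m (\mathbb{C}^k)^{\otimes d}$. A slice in direction $\ell$ is the set of cells with fixed $\ell$-th coordinate; a magic set is a subset $T\subseteq[k]^d$ with the same number of elements in every slice. Let $\mathcal{B}_{d,k}(n) := \mathrm{span}\{\psi_P : P \text{ a magic set of cardinality } nk\}$. The group $\mathrm{GL}(k)^{\times d}$ acts on $(\mathbb{C}^k)^{\otimes d}$ factorwise and hence on exterior powers; its Lie algebra $\mathfrak{gl}(k)^{\times d}$ acts by derivations. For $\ell\in[d]$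 and $i\in[k-1]$, the raising operator $E^{(\ell)}_{i,i+1}$ is the element of $\mathfrak{gl}(k)^{\times d}$ with the matrix unit $E_{i,i+1}$ in the $\ell$-th component and $0$ elsewhere. A highest weight vector in $\mathcal{B}_{d,k}(n)$ is a nonzero $v\in\mathcal{B}_{d,k}(n)$ annihilated by all raising operators. Define $$\omega := \sum_{\pi_2,\ldots,\pi_d\in S_k} \mathrm{sgn}(\pi_2\cdots\pi_d) \bigwedge_{i=1}^k e_i\otimes e_{\pi_2(i)}\otimes\cdots\otimes e_{\pi_d(i)} \in \mathcal{B}_{d,k}(1),$$ and $\omega^n := \omega\wedge\cdots\wedge\omega$ ($n$ factors). For a magic set $T$ of cardinality $nk$: a partial Latin hypercube of type $T$ is $C:[k]^d\to\{0,\ldots,n\}$ with $C(a)\ne0$ iff $a\in T$ and such that on each slice the nonzero values, read in lexicographic order of cells, form a permutation of $[n]$; $\mathrm{sgn}(C)$ is the product of the signs of these permutations over all $dk$ slices; $AT_d(k,T) := \sum_C \mathrm{sgn}(C)$ over all partial Latin hypercubes of type $T$, and $AT_d(k) := AT_d(k,[k]^d)$. For a sequence $a$, $\mathrm{msgn}(a) := (-1)^{\#\text{inversions of } a}$; if $x_1<\cdots<x_{nk}$ are the elements of $T$ and $T_\ell$ is the sequence of their $\ell$-th coordinates, $\mathrm{sgn}(T) := \prod_{\ell=1}^d \mathrm{msgn}(T_\ell)$. *)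

theory Defs
  imports
    Complex_Main
    "HOL-Library.FuncSet"
    "HOL-Library.List_Lexorder"
    "HOL-Combinatorics.Combinatorics"
begin

section \<open>The exterior algebra of a complex vector space with an ordered basis\<close>

text \<open>
  The exterior algebra of the free complex vector space on a linearly ordered type: a vector is
  given by its coordinates with respect to the basis of the wedge products
  \<open>b\<^sub>1 \<and> \<dots> \<and> b\<^sub>m\<close> with \<open>b\<^sub>1 < \<dots> < b\<^sub>m\<close>, which are indexed by the finite sets
  \<open>{b\<^sub>1, \<dots>, b\<^sub>m}\<close>. The wedge product is written \<open>*\<close> (so \<open>^\<close> and \<open>prod_list\<close> are iterated
  wedge products). The lemmas below show that this is an associative unital algebra in
  which vectors of degree one anticommute.
\<close>

typedef 'b exterior =
  "{f :: 'b set \<Rightarrow> complex. finite {S. f S \<noteq> 0} \<and> (\<forall>S. f S \<noteq> 0 \<longrightarrow> finite S)}"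
  morphisms coeff Abs_exterior
  by (rule exI[of _ "\<lambda>_. 0"]) simp

setup_lifting type_definition_exterior

lemma coeff_finite_support: "finite {S. coeff x S \<noteq> 0}"
  and coeff_infinite: "infinite S \<Longrightarrow> coeff x S = 0"
  using coeff[of x] by blast+

lemma exterior_eqI:
  assumes "\<And>S. finite S \<Longrightarrow> coeff x S = coeff y S"
  shows "x = y"
proof -
  have "coeff x S = coeff y S" for S
    using assms coeff_infinite[of S] by (cases "finite S") simp_all
  then show ?thesis by (simp add: coeff_inject[symmetric] fun_eq_iff)
qed

instantiation exterior :: (type) ab_group_add
begin

lift_definition zero_exterior :: "'a exterior" is "\<lambda>_. 0" by simp

lift_definition plus_exterior :: "'a exterior \<Rightarrow> 'a exterior \<Rightarrow> 'a exterior"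
  is "\<lambda>f g S. f S + g S"
proof -
  fix f g :: "'a set \<Rightarrow> complex"
  assume a: "finite {S. f S \<noteq> 0} \<and> (\<forall>S. f S \<noteq> 0 \<longrightarrow> finite S)"
    "finite {S. g S \<noteq> 0} \<and> (\<forall>S. g S \<noteq> 0 \<longrightarrow> finite S)"
  have "{S. f S + g S \<noteq> 0} \<subseteq> {S. f S \<noteq> 0} \<union> {S. g S \<noteq> 0}" by auto
  then have "finite {S. f S + g S \<noteq> 0}"
    using a by (auto intro: finite_subset)
  moreover have "finite S" if "f S + g S \<noteq> 0" for S
    using a that by (cases "f S = 0") simp_all
  ultimately show "finite {S. f S + g S \<noteq> 0} \<and> (\<forall>S. f S + g S \<noteq> 0 \<longrightarrow> finite S)" by blast
qed

lift_definition uminus_exterior :: "'a exterior \<Rightarrow> 'a exterior" is "\<lambda>f S. - f S" by simp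

definition minus_exterior :: "'a exterior \<Rightarrow> 'a exterior \<Rightarrow> 'a exterior"
  where "minus_exterior x y = x + - y"

instance
proof
  fix x y z :: "'a exterior"
  show "x + y + z = x + (y + z)" by transfer (simp add: add.assoc)
  show "x + y = y + x" by transfer (simp add: add.commute)
  show "0 + x = x" by transfer simp
  show "- x + x = 0" by transfer simp
  show "x - y = x + - y" by (rule minus_exterior_def)
qed

end

lift_definition scale :: "complex \<Rightarrow> 'b exterior \<Rightarrow> 'b exterior" is "\<lambda>c f S. c * f S"
proof -
  fix c and f :: "'b set \<Rightarrow> complex"
  assume a: "finite {S. f S \<noteq> 0} \<and> (\<forall>S. f S \<noteq> 0 \<longrightarrow> finite S)"
  have "finite {S. c * f S \<noteq> 0}"
    by (rule finite_subset[of _ "{S. f S \<noteq> 0}"]) (use a in auto)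
  with a show "finite {S. c * f S \<noteq> 0} \<and> (\<forall>S. c * f S \<noteq> 0 \<longrightarrow> finite S)" by simp
qed

lemma coeff_simps [simp]:
  "coeff 0 S = 0"
  "coeff (x + y) S = coeff x S + coeff y S"
  "coeff (- x) S = - coeff x S"
  "coeff (x - y) S = coeff x S - coeff y S"
  "coeff (scale c x) S = c * coeff x S"
  by (simp_all add: zero_exterior.rep_eq plus_exterior.rep_eq uminus_exterior.rep_eq
      scale.rep_eq diff_conv_add_uminus del: add_uminus_conv_diff)

lemma coeff_sum [simp]: "coeff (sum f A) S = (\<Sum>a\<in>A. coeff (f a) S)"
  by (induction A rule: infinite_finite_induct) simp_all

global_interpretation exterior: vector_space "scale :: complex \<Rightarrow> 'b exterior \<Rightarrow> 'b exterior"
  by standard (rule exterior_eqI; simp add: ring_distribs)+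

definition shuffle_sign :: "'b::linorder set \<Rightarrow> 'b set \<Rightarrow> complex" where
  "shuffle_sign A B = (- 1) ^ card {(a, b). a \<in> A \<and> b \<in> B \<and> b < a}"

lemma finite_inv_pairs:
  "finite A \<Longrightarrow> finite B \<Longrightarrow> finite {(a, b). a \<in> A \<and> b \<in> B \<and> (b::'b::linorder) < a}"
  by (rule finite_subset[of _ "A \<times> B"]) auto

lemma shuffle_sign_Un_left:
  assumes "finite A" "finite B" "finite C" "A \<inter> B = {}"
  shows "shuffle_sign (A \<union> B) C = shuffle_sign A C * shuffle_sign B C"
proof -
  have "{(a, b). a \<in> A \<union> B \<and> b \<in> C \<and> b < a} =
      {(a, b). a \<in> A \<and> b \<in> C \<and> b < a} \<union> {(a, b). a \<in> B \<and> b \<in> C \<and> b < a}" by auto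
  moreover have "{(a, b). a \<in> A \<and> b \<in> C \<and> b < a} \<inter> {(a, b). a \<in> B \<and> b \<in> C \<and> b < a} = {}"
    using assms by auto
  ultimately show ?thesis
    using assms unfolding shuffle_sign_def
    by (simp add: card_Un_disjoint finite_inv_pairs power_add)
qed

lemma shuffle_sign_Un_right:
  assumes "finite A" "finite B" "finite C" "B \<inter> C = {}"
  shows "shuffle_sign A (B \<union> C) = shuffle_sign A B * shuffle_sign A C"
proof -
  have "{(a, b). a \<in> A \<and> b \<in> B \<union> C \<and> b < a} =
      {(a, b). a \<in> A \<and> b \<in> B \<and> b < a} \<union> {(a, b). a \<in> A \<and> b \<in> C \<and> b < a}" by auto
  moreover have "{(a, b). a \<in> A \<and> b \<in> B \<and> b < a} \<inter> {(a, b). a \<in> A \<and> b \<in> C \<and> b < a} = {}"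
    using assms by auto
  ultimately show ?thesis
    using assms unfolding shuffle_sign_def
    by (simp add: card_Un_disjoint finite_inv_pairs power_add)
qed

lemma shuffle_sign_empty [simp]: "shuffle_sign {} A = 1" "shuffle_sign A {} = 1"
  by (simp_all add: shuffle_sign_def)

instantiation exterior :: (linorder) ring_1
begin

lift_definition one_exterior :: "'a exterior" is "\<lambda>S. if S = {} then 1 else 0" by simp

lift_definition times_exterior :: "'a exterior \<Rightarrow> 'a exterior \<Rightarrow> 'a exterior"
  is "\<lambda>f g S. \<Sum>A\<in>Pow S. shuffle_sign A (S - A) * f A * g (S - A)"
proof -
  fix f g :: "'a set \<Rightarrow> complex"
  let ?h = "\<lambda>S. \<Sum>A\<in>Pow S. shuffle_sign A (S - A) * f A * g (S - A)"
  assume a: "finite {S. f S \<noteq> 0} \<and> (\<forall>S. f S \<noteq> 0 \<longrightarrow> finite S)"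
    "finite {S. g S \<noteq> 0} \<and> (\<forall>S. g S \<noteq> 0 \<longrightarrow> finite S)"
  have *: "\<exists>A\<subseteq>S. f A \<noteq> 0 \<and> g (S - A) \<noteq> 0" if "?h S \<noteq> 0" for S
    using sum.not_neutral_contains_not_neutral[OF that] by auto
  have "{S. ?h S \<noteq> 0} \<subseteq> (\<lambda>(A, B). A \<union> B) ` ({S. f S \<noteq> 0} \<times> {S. g S \<noteq> 0})"
  proof
    fix S assume "S \<in> {S. ?h S \<noteq> 0}"
    then obtain A where "A \<subseteq> S" "f A \<noteq> 0" "g (S - A) \<noteq> 0" using * by blast
    then show "S \<in> (\<lambda>(A, B). A \<union> B) ` ({S. f S \<noteq> 0} \<times> {S. g S \<noteq> 0})"
      by (intro image_eqI[of _ _ "(A, S - A)"]) auto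
  qed
  then have "finite {S. ?h S \<noteq> 0}"
    using a by (meson finite_SigmaI finite_imageI finite_subset)
  moreover have "finite S" if "?h S \<noteq> 0" for S
    using *[OF that] a by (metis finite_Diff2)
  ultimately show "finite {S. ?h S \<noteq> 0} \<and> (\<forall>S. ?h S \<noteq> 0 \<longrightarrow> finite S)" by blast
qed

instance
proof
  fix x y z :: "'a exterior"
  show "x * y * z = x * (y * z)"
  proof (rule exterior_eqI)
    fix S :: "'a set" assume S: "finite S"
    let ?t = "\<lambda>A B C. shuffle_sign A B * shuffle_sign A C * shuffle_sign B C *
      coeff x A * coeff y B * coeff z C"
    have "coeff (x * y * z) S = (\<Sum>A\<in>Pow S. \<Sum>B\<in>Pow A.
        shuffle_sign A (S - A) * shuffle_sign B (A - B) *
        coeff x B * coeff y (A - B) * coeff z (S - A))"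
      by (simp add: times_exterior.rep_eq sum_distrib_left sum_distrib_right mult_ac)
    also have "\<dots> = (\<Sum>A\<in>Pow S. \<Sum>B\<in>Pow A. ?t B (A - B) (S - A))"
    proof (intro sum.cong refl)
      fix A B assume AB: "A \<in> Pow S" "B \<in> Pow A"
      then have "B \<union> (A - B) = A" by auto
      moreover have "finite B" "finite (A - B)" "finite (S - A)"
        using AB S by (auto intro: finite_subset)
      ultimately have "shuffle_sign A (S - A) =
          shuffle_sign B (S - A) * shuffle_sign (A - B) (S - A)"
        using shuffle_sign_Un_left[of B "A - B" "S - A"] by auto
      then show "shuffle_sign A (S - A) * shuffle_sign B (A - B) *
          coeff x B * coeff y (A - B) * coeff z (S - A) = ?t B (A - B) (S - A)" by simp
    qed
    also have "\<dots> = (\<Sum>(A, B)\<in>Sigma (Pow S) Pow. ?t B (A - B) (S - A))"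
      using S by (subst sum.Sigma) (auto intro: finite_subset)
    also have "\<dots> = (\<Sum>(B, C)\<in>Sigma (Pow S) (\<lambda>B. Pow (S - B)). ?t B C (S - B - C))"
    proof (rule sum.reindex_bij_witness[where i = "\<lambda>(B, C). (B \<union> C, B)"
          and j = "\<lambda>(A, B). (B, A - B)"], goal_cases)
      case (5 p)
      obtain A B where p: "p = (A, B)" by force
      with 5 have "S - B - (A - B) = S - A" by auto
      then show ?case by (simp add: p)
    qed auto
    also have "\<dots> = (\<Sum>B\<in>Pow S. \<Sum>C\<in>Pow (S - B). ?t B C (S - B - C))"
      using S by (subst sum.Sigma) (auto intro: finite_subset)
    also have "\<dots> = (\<Sum>B\<in>Pow S. \<Sum>C\<in>Pow (S - B).
        shuffle_sign B (S - B) * shuffle_sign C (S - B - C) *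
        coeff x B * coeff y C * coeff z (S - B - C))"
    proof (intro sum.cong refl)
      fix B C assume BC: "B \<in> Pow S" "C \<in> Pow (S - B)"
      then have "C \<union> (S - B - C) = S - B" by auto
      moreover have "finite B" "finite C" "finite (S - B - C)"
        using BC S by (auto intro: finite_subset)
      ultimately have "shuffle_sign B (S - B) =
          shuffle_sign B C * shuffle_sign B (S - B - C)"
        using shuffle_sign_Un_right[of B C "S - B - C"] by auto
      then show "?t B C (S - B - C) =
        shuffle_sign B (S - B) * shuffle_sign C (S - B - C) *
        coeff x B * coeff y C * coeff z (S - B - C)" by simp
    qed
    also have "\<dots> = coeff (x * (y * z)) S"
      by (simp add: times_exterior.rep_eq sum_distrib_left sum_distrib_right mult_ac)
    finally show "coeff (x * y * z) S = coeff (x * (y * z)) S" .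
  qed
  show "1 * x = x"
  proof (rule exterior_eqI)
    fix S :: "'a set" assume S: "finite S"
    have "coeff (1 * x) S = (\<Sum>A\<in>Pow S. if A = {} then coeff x S else 0)"
      unfolding times_exterior.rep_eq one_exterior.rep_eq by (intro sum.cong) auto
    then show "coeff (1 * x) S = coeff x S" using S by (simp add: sum.delta)
  qed
  show "x * 1 = x"
  proof (rule exterior_eqI)
    fix S :: "'a set" assume S: "finite S"
    have "coeff (x * 1) S = (\<Sum>A\<in>Pow S. if A = S then coeff x S else 0)"
      unfolding times_exterior.rep_eq one_exterior.rep_eq by (intro sum.cong) auto
    then show "coeff (x * 1) S = coeff x S" using S by (simp add: sum.delta)
  qed
  show "(x + y) * z = x * z + y * z" "x * (y + z) = x * y + x * z"
    by (auto intro!: exterior_eqI simp: times_exterior.rep_eq algebra_simps sum.distrib)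
  show "(0::'a exterior) \<noteq> 1"
  proof
    assume "(0::'a exterior) = 1"
    then have "coeff (0::'a exterior) {} = coeff 1 {}" by simp
    then show False by (simp add: one_exterior.rep_eq)
  qed
qed

end

lemma scale_mult_left [simp]: "scale c x * y = scale c (x * y)"
  and scale_mult_right [simp]: "x * scale c y = scale c (x * y)"
  by (auto intro!: exterior_eqI simp: times_exterior.rep_eq sum_distrib_left mult_ac)

lift_definition gen :: "'b \<Rightarrow> 'b exterior" is "\<lambda>b S. if S = {b} then 1 else 0" by simp

definition psi :: "'b::linorder set \<Rightarrow> 'b exterior" where
  "psi P = prod_list (map gen (sorted_list_of_set P))"

lemma coeff_gen_mult:
  assumes "finite S"
  shows "coeff (gen x * y) S = (if x \<in> S then shuffle_sign {x} (S - {x}) * coeff y (S - {x}) else 0)"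
proof -
  have "coeff (gen x * y) S =
      (\<Sum>A\<in>Pow S. if A = {x} then shuffle_sign {x} (S - {x}) * coeff y (S - {x}) else 0)"
    unfolding times_exterior.rep_eq gen.rep_eq by (intro sum.cong) auto
  then show ?thesis using assms by (simp add: sum.delta)
qed

lemma shuffle_sign_less:
  assumes "\<forall>a\<in>A. \<forall>b\<in>B. a < b"
  shows "shuffle_sign A B = 1"
proof -
  have "{(a, b). a \<in> A \<and> b \<in> B \<and> b < a} = {}" using assms by (force dest: order.asym)
  then show ?thesis unfolding shuffle_sign_def by (simp only: card.empty power_0)
qed

lemma coeff_prod_list_sorted:
  "sorted_wrt (<) xs \<Longrightarrow> finite S \<Longrightarrow>
    coeff (prod_list (map gen xs)) S = (if S = set xs then 1 else 0)"
proof (induction xs arbitrary: S)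
  case Nil
  then show ?case by (simp add: one_exterior.rep_eq)
next
  case (Cons x xs)
  have x: "x \<notin> set xs" "\<forall>y\<in>set xs. x < y" using Cons.prems by auto
  have "shuffle_sign {x} (S - {x}) = 1" if "S - {x} = set xs"
    using x that by (intro shuffle_sign_less) auto
  moreover have "x \<in> S \<and> S - {x} = set xs \<longleftrightarrow> S = insert x (set xs)" using x by auto
  ultimately show ?case
    using Cons by (auto simp: coeff_gen_mult)
qed

lemma coeff_psi: "finite P \<Longrightarrow> coeff (psi P) S = (if S = P then 1 else 0)"
  by (cases "finite S") (auto simp: psi_def coeff_prod_list_sorted coeff_infinite)

lemma exterior_expand: "x = (\<Sum>P | coeff x P \<noteq> 0. scale (coeff x P) (psi P))"
proof (rule exterior_eqI)
  fix S :: "'a set" assume "finite S"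
  have "coeff (\<Sum>P | coeff x P \<noteq> 0. scale (coeff x P) (psi P)) S =
      (\<Sum>P | coeff x P \<noteq> 0. if P = S then coeff x S else 0)"
    unfolding coeff_sum
  proof (intro sum.cong refl)
    fix P assume "P \<in> {P. coeff x P \<noteq> 0}"
    then have "finite P" using coeff_infinite[of P x] by auto
    then show "coeff (scale (coeff x P) (psi P)) S = (if P = S then coeff x S else 0)"
      by (auto simp: coeff_psi)
  qed
  then show "coeff x S = coeff (\<Sum>P | coeff x P \<noteq> 0. scale (coeff x P) (psi P)) S"
    by (simp add: sum.delta coeff_finite_support)
qed

lemma gen_anticommute: "gen x * gen y = - (gen y * gen x)"
proof (rule exterior_eqI)
  fix S :: "'a set" assume S: "finite S"
  have 1: "shuffle_sign {x} {y} = - shuffle_sign {y} {x}" if "x \<noteq> y" for x y :: 'a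
  proof -
    have "{(a, b). a \<in> {x} \<and> b \<in> {y} \<and> b < a} = (if y < x then {(x, y)} else {})"
      "{(a, b). a \<in> {y} \<and> b \<in> {x} \<and> b < a} = (if x < y then {(y, x)} else {})" by auto
    then show ?thesis using that by (auto simp: shuffle_sign_def)
  qed
  show "coeff (gen x * gen y) S = coeff (- (gen y * gen x)) S"
  proof (cases "x \<noteq> y \<and> S = {x, y}")
    case True
    then have "S - {x} = {y}" "S - {y} = {x}" by auto
    with True 1[of x y] show ?thesis by (simp add: coeff_gen_mult gen.rep_eq)
  next
    case False
    then have "\<not> (x \<in> S \<and> S - {x} = {y})" "\<not> (y \<in> S \<and> S - {y} = {x})" by auto
    with S show ?thesis by (auto simp: coeff_gen_mult gen.rep_eq)
  qed
qed

lemma gen_square: "gen x * gen x = 0"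
proof (rule exterior_eqI)
  fix S :: "'a set" assume "finite S"
  then show "coeff (gen x * gen x) S = coeff 0 S"
    by (auto simp: coeff_gen_mult gen.rep_eq)
qed

lemma degree_one_anticommute:
  assumes "u \<in> exterior.span (range gen)" "v \<in> exterior.span (range gen)"
  shows "u * v = - (v * u)"
proof -
  have "gen x * v = - (v * gen x)" for x :: 'a
    using assms(2)
    by (induction rule: exterior.span_induct_alt)
      (auto simp: algebra_simps gen_anticommute[of x])
  with assms(1) show ?thesis
    by (induction rule: exterior.span_induct_alt) (auto simp: algebra_simps)
qed

text \<open>
  The extension of a linear map \<open>f\<close> from the space of degree one (given by the images
  \<open>f b\<close> of the basis vectors) to the exterior algebra:
  \<open>b\<^sub>1 \<and> \<dots> \<and> b\<^sub>m\<close> is sent to the sum over \<open>j\<close> of \<open>b\<^sub>1 \<and> \<dots> \<and> f b\<^sub>j \<and> \<dots> \<and> b\<^sub>m\<close>.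
  If the \<open>f b\<close> have degree one, then this is the derivation extending \<open>f\<close>; see
  \<open>derivation_ext_mult\<close>.
\<close>

definition derivation_list :: "('b \<Rightarrow> 'b exterior) \<Rightarrow> 'b::linorder list \<Rightarrow> 'b exterior" where
  "derivation_list f xs = (\<Sum>j<length xs. prod_list ((map gen xs)[j := f (xs ! j)]))"

definition derivation_ext :: "('b \<Rightarrow> 'b exterior) \<Rightarrow> 'b::linorder exterior \<Rightarrow> 'b exterior" where
  "derivation_ext f x =
    (\<Sum>P | coeff x P \<noteq> 0. scale (coeff x P) (derivation_list f (sorted_list_of_set P)))"

lemma derivation_ext_eq:
  assumes "finite F" "{P. coeff x P \<noteq> 0} \<subseteq> F"
  shows "derivation_ext f x =
    (\<Sum>P\<in>F. scale (coeff x P) (derivation_list f (sorted_list_of_set P)))"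
  unfolding derivation_ext_def using assms by (intro sum.mono_neutral_left) auto

lemma derivation_ext_add: "derivation_ext f (x + y) = derivation_ext f x + derivation_ext f y"
proof -
  let ?F = "{P. coeff x P \<noteq> 0} \<union> {P. coeff y P \<noteq> 0}"
  have F: "finite ?F" by (simp add: coeff_finite_support)
  show ?thesis
    by (subst (1 2 3) derivation_ext_eq[OF F])
      (auto simp: sum.distrib[symmetric] exterior.scale_left_distrib)
qed

lemma derivation_ext_scale: "derivation_ext f (scale c x) = scale c (derivation_ext f x)"
proof -
  have F: "finite {P. coeff x P \<noteq> 0}" by (simp add: coeff_finite_support)
  show ?thesis
    by (subst (1 2) derivation_ext_eq[OF F])
      (auto simp: exterior.scale_sum_right)
qed

lemma derivation_ext_zero [simp]: "derivation_ext f 0 = 0"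
  by (simp add: derivation_ext_def)

lemma derivation_ext_sum: "derivation_ext f (sum g A) = (\<Sum>a\<in>A. derivation_ext f (g a))"
  by (induction A rule: infinite_finite_induct) (simp_all add: derivation_ext_add)

lemma derivation_ext_psi:
  "finite P \<Longrightarrow> derivation_ext f (psi P) = derivation_list f (sorted_list_of_set P)"
  by (subst derivation_ext_eq[of "{P}"]) (auto simp: coeff_psi)

lemma derivation_list_Nil [simp]: "derivation_list f [] = 0"
  by (simp add: derivation_list_def)

lemma derivation_list_Cons [simp]:
  "derivation_list f (x # xs) = f x * prod_list (map gen xs) + gen x * derivation_list f xs"
  by (simp add: derivation_list_def sum.lessThan_Suc_shift sum_distrib_left
      del: sum.lessThan_Suc)

lemma derivation_list_append:
  "derivation_list f (xs @ ys) =
    derivation_list f xs * prod_list (map gen ys) + prod_list (map gen xs) * derivation_list f ys"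
  by (induction xs) (simp_all add: algebra_simps)

lemma prod_list_gen_sort_Cons:
  fixes f :: "'b::linorder \<Rightarrow> 'b exterior"
  assumes f: "\<And>b. f b \<in> exterior.span (range gen)"
  shows "sorted_wrt (<) xs \<Longrightarrow> \<exists>c ys. sorted_wrt (<) ys \<and> set ys \<subseteq> insert x (set xs) \<and>
    prod_list (map gen (x # xs)) = scale c (prod_list (map gen ys)) \<and>
    derivation_list f (x # xs) = scale c (derivation_list f ys)"
proof (induction xs)
  case Nil
  show ?case by (intro exI[of _ 1] exI[of _ "[x]"]) simp
next
  case (Cons y xs)
  have gen: "gen b \<in> exterior.span (range gen)" for b :: 'b
    by (rule exterior.span_base) simp
  consider "x < y" | "x = y" | "y < x" by force
  then show ?case
  proof cases
    case 1
    with Cons.prems show ?thesis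
      by (intro exI[of _ 1] exI[of _ "x # y # xs"]) auto
  next
    case 2
    have "f y * gen y + gen y * f y = 0"
      using degree_one_anticommute[OF f[of y] gen[of y]] by simp
    then have "(f y * gen y + gen y * f y) * prod_list (map gen xs) +
        gen y * gen y * derivation_list f xs = 0"
      by (simp add: gen_square)
    then have "derivation_list f (x # y # xs) = 0"
      using 2 by (simp add: algebra_simps)
    moreover have "prod_list (map gen (x # y # xs)) = 0"
      using 2 by (simp add: mult.assoc[symmetric] gen_square)
    ultimately show ?thesis by (intro exI[of _ 0] exI[of _ "[]"]) simp
  next
    case 3
    have "sorted_wrt (<) xs" using Cons.prems by simp
    from Cons.IH[OF this] obtain c ys where ys: "sorted_wrt (<) ys" "set ys \<subseteq> insert x (set xs)"
      "prod_list (map gen (x # xs)) = scale c (prod_list (map gen ys))"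
      "derivation_list f (x # xs) = scale c (derivation_list f ys)" by blast
    let ?P = "prod_list (map gen xs)" and ?D = "derivation_list f xs"
    have a: "gen x * gen y = - (gen y * gen x)" by (rule gen_anticommute)
    have b: "f x * gen y = - (gen y * f x)" "gen x * f y = - (f y * gen x)"
      by (rule degree_one_anticommute[OF f gen] degree_one_anticommute[OF gen f])+
    have P: "prod_list (map gen (x # y # xs)) = - (gen y * prod_list (map gen (x # xs)))"
      using a by (simp add: mult.assoc[symmetric])
    have "derivation_list f (x # y # xs) =
        (f x * gen y) * ?P + (gen x * f y) * ?P + (gen x * gen y) * ?D"
      by (simp add: algebra_simps)
    also have "\<dots> = - (f y * prod_list (map gen (x # xs)) + gen y * derivation_list f (x # xs))"
      unfolding a b by (simp add: algebra_simps)
    finally have D: "derivation_list f (x # y # xs) =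
      - (f y * prod_list (map gen (x # xs)) + gen y * derivation_list f (x # xs))" .
    show ?thesis
    proof (intro exI[of _ "- c"] exI[of _ "y # ys"] conjI)
      show "sorted_wrt (<) (y # ys)" using ys 3 Cons.prems by auto
      show "set (y # ys) \<subseteq> insert x (set (y # xs))" using ys by auto
      show "prod_list (map gen (x # y # xs)) = scale (- c) (prod_list (map gen (y # ys)))"
        unfolding P ys(3) by simp
      show "derivation_list f (x # y # xs) = scale (- c) (derivation_list f (y # ys))"
        unfolding D ys(3,4) by (simp add: exterior.scale_right_distrib)
    qed
  qed
qed

lemma derivation_ext_prod_list:
  fixes f :: "'b::linorder \<Rightarrow> 'b exterior"
  assumes f: "\<And>b. f b \<in> exterior.span (range gen)"
  shows "derivation_ext f (prod_list (map gen xs)) = derivation_list f xs"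
proof -
  have "\<exists>c ys. sorted_wrt (<) ys \<and> prod_list (map gen xs) = scale c (prod_list (map gen ys)) \<and>
      derivation_list f xs = scale c (derivation_list f ys)"
  proof (induction xs)
    case Nil
    show ?case by (intro exI[of _ 1] exI[of _ "[]"]) simp
  next
    case (Cons x xs)
    then obtain c ys where ys: "sorted_wrt (<) ys"
      "prod_list (map gen xs) = scale c (prod_list (map gen ys))"
      "derivation_list f xs = scale c (derivation_list f ys)" by blast
    obtain c' zs where zs: "sorted_wrt (<) zs"
      "prod_list (map gen (x # ys)) = scale c' (prod_list (map gen zs))"
      "derivation_list f (x # ys) = scale c' (derivation_list f zs)"
      using prod_list_gen_sort_Cons[of f, OF f ys(1)] by blast
    have "prod_list (map gen (x # xs)) = scale c (prod_list (map gen (x # ys)))"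
      using ys by simp
    moreover have "derivation_list f (x # xs) = scale c (derivation_list f (x # ys))"
      using ys by (simp add: exterior.scale_right_distrib)
    ultimately show ?case
      unfolding zs using zs(1) by (intro exI[of _ "c * c'"] exI[of _ zs]) simp
  qed
  then obtain c ys where ys: "sorted_wrt (<) ys"
    "prod_list (map gen xs) = scale c (prod_list (map gen ys))"
    "derivation_list f xs = scale c (derivation_list f ys)" by blast
  have "sorted_list_of_set (set ys) = ys"
    using ys(1) by (simp add: strict_sorted_iff sorted_list_of_set_sort_remdups
        distinct_remdups_id sorted_sort_id)
  then have "prod_list (map gen ys) = psi (set ys)" by (simp add: psi_def)
  then have "derivation_ext f (prod_list (map gen ys)) = derivation_list f ys"
    using \<open>sorted_list_of_set (set ys) = ys\<close> by (simp add: derivation_ext_psi)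
  then show ?thesis unfolding ys by (simp add: derivation_ext_scale)
qed

lemma derivation_ext_mult:
  fixes f :: "'b::linorder \<Rightarrow> 'b exterior"
  assumes f: "\<And>b. f b \<in> exterior.span (range gen)"
  shows "derivation_ext f (x * y) = derivation_ext f x * y + x * derivation_ext f y"
proof -
  have psi: "derivation_ext f (psi P * psi Q) =
      derivation_ext f (psi P) * psi Q + psi P * derivation_ext f (psi Q)" for P Q :: "'b set"
    unfolding psi_def prod_list.append[symmetric] map_append[symmetric]
    by (simp only: derivation_ext_prod_list[OF f] derivation_list_append)
  define p q where "p = coeff x" and "q = coeff y"
  define X Y where "X = {P. p P \<noteq> 0}" and "Y = {P. q P \<noteq> 0}"
  have x: "x = (\<Sum>P\<in>X. scale (p P) (psi P))" and y: "y = (\<Sum>P\<in>Y. scale (q P) (psi P))"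
    unfolding X_def Y_def p_def q_def by (rule exterior_expand)+
  show ?thesis
    unfolding x y
    by (simp add: sum_distrib_left sum_distrib_right derivation_ext_sum derivation_ext_scale psi
        exterior.scale_right_distrib exterior.scale_sum_right sum.distrib)
qed


section \<open>Tensor power and Lie algebra action\<close>

text \<open>
  Cells are lists, ordered lexicographically by the order instance of
  \<^theory>\<open>HOL-Library.List_Lexorder\<close>. Their entries lie in \<open>{1..k}\<close>, but directions
  (positions in the list) are numbered \<open>0, \<dots>, d - 1\<close>.
\<close>

definition cells :: "nat \<Rightarrow> nat \<Rightarrow> nat list set" where
  "cells d k = {a. length a = d \<and> set a \<subseteq> {1..k}}"

text \<open>
  A vector of \<open>\<complex>\<^sup>k\<close> is given by its coordinates with indices in \<open>{1..k}\<close> (other values are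
  ignored). The \<open>d\<close>-th tensor power of \<open>\<complex>\<^sup>k\<close> is the space of degree one spanned by
  the \<open>gen a\<close> for \<open>a \<in> cells d k\<close>; the coordinate of \<open>v\<^sub>0 \<otimes> \<dots> \<otimes> v\<^sub>d\<^sub>-\<^sub>1\<close> at the cell \<open>a\<close> is
  the product of the \<open>v\<^sub>l (a ! l)\<close>.
\<close>

definition std :: "nat \<Rightarrow> nat \<Rightarrow> complex" where
  "std i = (\<lambda>j. if j = i then 1 else 0)"

definition tensor :: "nat \<Rightarrow> (nat \<Rightarrow> complex) list \<Rightarrow> nat list exterior" where
  "tensor k vs =
    (\<Sum>a\<in>cells (length vs) k. scale (\<Prod>l<length vs. (vs ! l) (a ! l)) (gen a))"

lemma finite_cells: "finite (cells d k)"
  using finite_lists_length_eq[of "{1..k}" d] by (simp add: cells_def conj_commute)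

lemma tensor_std:
  assumes "a \<in> cells d k"
  shows "tensor k (map std a) = gen a"
proof -
  have d: "length a = d" using assms by (simp add: cells_def)
  have "(\<Prod>l<d. (map std a ! l) (b ! l)) = (if b = a then 1 else 0)" if "b \<in> cells d k" for b
  proof (cases "b = a")
    case True
    then show ?thesis using d by (auto simp: std_def)
  next
    case False
    moreover have "length b = d" using that by (simp add: cells_def)
    ultimately obtain l where "l < d" "b ! l \<noteq> a ! l"
      using d nth_equalityI[of b a] by metis
    then have "(\<Prod>l<d. (map std a ! l) (b ! l)) = 0"
      using d by (intro prod_zero bexI[of _ l]) (auto simp: std_def)
    then show ?thesis using False by simp
  qed
  then have "tensor k (map std a) = (\<Sum>b\<in>cells d k. if b = a then gen b else 0)"
    unfolding tensor_def length_map d by (intro sum.cong refl) auto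
  then show ?thesis using assms by (simp add: finite_cells)
qed

definition matvec :: "nat \<Rightarrow> (nat \<Rightarrow> nat \<Rightarrow> complex) \<Rightarrow> (nat \<Rightarrow> complex) \<Rightarrow> nat \<Rightarrow> complex" where
  "matvec k M v = (\<lambda>i. \<Sum>j\<in>{1..k}. M i j * v j)"

text \<open>
  An element \<open>X\<close> of the Lie algebra is a tuple of \<open>k \<times> k\<close> matrices \<open>X 0, \<dots>, X (d - 1)\<close> with
  indices in \<open>{1..k}\<close>. It acts on a tensor product of vectors as the sum over \<open>l\<close> of the
  application of \<open>X l\<close> to the \<open>l\<close>-th factor.
\<close>

definition gl_tensor :: "nat \<Rightarrow> nat \<Rightarrow> (nat \<Rightarrow> nat \<Rightarrow> nat \<Rightarrow> complex) \<Rightarrow> nat list \<Rightarrow> nat list exterior" where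
  "gl_tensor d k X a = (\<Sum>l<d. tensor k ((map std a)[l := matvec k (X l) (std (a ! l))]))"

lemma gl_tensor_degree_one: "gl_tensor d k X a \<in> exterior.span (range gen)"
  unfolding gl_tensor_def tensor_def
  by (intro exterior.span_sum exterior.span_scale exterior.span_base) simp

definition gl_act :: "nat \<Rightarrow> nat \<Rightarrow> (nat \<Rightarrow> nat \<Rightarrow> nat \<Rightarrow> complex) \<Rightarrow>
    nat list exterior \<Rightarrow> nat list exterior" where
  "gl_act d k X = derivation_ext (gl_tensor d k X)"

definition matrix_unit :: "nat \<Rightarrow> nat \<Rightarrow> nat \<Rightarrow> nat \<Rightarrow> complex" where
  "matrix_unit i j = (\<lambda>r s. if r = i \<and> s = j then 1 else 0)"

definition raising :: "nat \<Rightarrow> nat \<Rightarrow> nat \<Rightarrow> nat \<Rightarrow> nat \<Rightarrow> complex" where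
  "raising l i = (\<lambda>m. if m = l then matrix_unit i (i + 1) else (\<lambda>_ _. 0))"


section \<open>Magic sets and highest weight vectors\<close>

definition slice :: "nat \<Rightarrow> nat \<Rightarrow> nat \<Rightarrow> nat \<Rightarrow> nat list set" where
  "slice d k l i = {a \<in> cells d k. a ! l = i}"

definition magic :: "nat \<Rightarrow> nat \<Rightarrow> nat list set \<Rightarrow> bool" where
  "magic d k T \<longleftrightarrow> T \<subseteq> cells d k \<and>
    (\<exists>c. \<forall>l<d. \<forall>i\<in>{1..k}. card (T \<inter> slice d k l i) = c)"

definition magic_space :: "nat \<Rightarrow> nat \<Rightarrow> nat \<Rightarrow> nat list exterior set" where
  "magic_space d k n = exterior.span {psi P | P. magic d k P \<and> card P = n * k}"

definition highest_weight_vector :: "nat \<Rightarrow> nat \<Rightarrow> nat \<Rightarrow> nat list exterior \<Rightarrow> bool" where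
  "highest_weight_vector d k n v \<longleftrightarrow> v \<in> magic_space d k n \<and> v \<noteq> 0 \<and>
    (\<forall>l<d. \<forall>i\<in>{1..<k}. gl_act d k (raising l i) v = 0)"

text \<open>
  Since directions are numbered from 0, the permutation called \<open>\<pi>\<^sub>j\<close> in the usual notation
  with \<open>2 \<le> j \<le> d\<close> is \<open>p (j - 1)\<close> here.
\<close>

definition omega :: "nat \<Rightarrow> nat \<Rightarrow> nat list exterior" where
  "omega d k = (\<Sum>p \<in> {1..<d} \<rightarrow>\<^sub>E {\<pi>. \<pi> permutes {1..k}}.
    scale (of_int (sign (foldr (\<circ>) (map p [1..<d]) id)))
      (prod_list (map (\<lambda>i. tensor k (std i # map (\<lambda>j. std (p j i)) [1..<d])) [1..<k+1])))"


section \<open>Partial Latin hypercubes\<close>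

definition slice_word :: "nat \<Rightarrow> nat \<Rightarrow> (nat list \<Rightarrow> nat) \<Rightarrow> nat \<Rightarrow> nat \<Rightarrow> nat list" where
  "slice_word d k C l i = filter (\<lambda>x. x \<noteq> 0) (map C (sorted_list_of_set (slice d k l i)))"

definition partial_latin_hypercubes :: "nat \<Rightarrow> nat \<Rightarrow> nat \<Rightarrow> nat list set \<Rightarrow> (nat list \<Rightarrow> nat) set" where
  "partial_latin_hypercubes d k n T =
    {C \<in> cells d k \<rightarrow>\<^sub>E {0..n}. (\<forall>a\<in>cells d k. C a \<noteq> 0 \<longleftrightarrow> a \<in> T) \<and>
      (\<forall>l<d. \<forall>i\<in>{1..k}. slice_word d k C l i \<in> permutations_of_set {1..n})}"

definition word_sign :: "nat list \<Rightarrow> int" where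
  "word_sign w = sign (\<lambda>i. if i \<in> {1..length w} then w ! (i - 1) else i)"

definition hypercube_sign :: "nat \<Rightarrow> nat \<Rightarrow> (nat list \<Rightarrow> nat) \<Rightarrow> int" where
  "hypercube_sign d k C = (\<Prod>l<d. \<Prod>i\<in>{1..k}. word_sign (slice_word d k C l i))"

text \<open>For a magic set \<open>T\<close> of cardinality \<open>n * k\<close> with \<open>k > 0\<close>, \<open>card T div k\<close> is \<open>n\<close>.\<close>

definition AT_type :: "nat \<Rightarrow> nat \<Rightarrow> nat list set \<Rightarrow> int" where
  "AT_type d k T = (\<Sum>C\<in>partial_latin_hypercubes d k (card T div k) T. hypercube_sign d k C)"

definition AT :: "nat \<Rightarrow> nat \<Rightarrow> int" where
  "AT d k = AT_type d k (cells d k)"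

definition msgn :: "nat list \<Rightarrow> int" where
  "msgn a = (- 1) ^ card {(i, j). i < j \<and> j < length a \<and> a ! j < a ! i}"

definition set_sign :: "nat \<Rightarrow> nat list set \<Rightarrow> int" where
  "set_sign d T = (\<Prod>l<d. msgn (map (\<lambda>a. a ! l) (sorted_list_of_set T)))"

end

theory Submission
  imports Defs
begin

text \<open>
  Every magic set of cardinality \<open>k\<close> is a diagonal: it meets each slice once and is described by
  permutations, and \<open>omega d k\<close> is the sum of the \<open>psi T\<close> over all diagonals \<open>T\<close>, weighted by
  \<open>set_sign d T\<close>.

  For (i), a raising operator applied to \<open>psi T\<close> replaces the entry \<open>i + 1\<close> in one direction by \<open>i\<close>.
  Exactly two diagonals have the same image under this, namely those that differ by exchanging the
  entries \<open>i\<close> and \<open>i + 1\<close> in that direction. So the terms of \<open>omega\<close> cancel in pairs, and the coefficient of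
  a highest weight vector at one diagonal determines those at all others, because the adjacent
  transpositions generate the symmetric group.

  For (ii), the coefficient of the power at \<open>T\<close> is a sum over the partitions of \<open>T\<close> into an ordered
  sequence of \<open>n\<close> diagonals, which are the partial Latin hypercubes \<open>C\<close> of type \<open>T\<close>. For every
  direction \<open>l\<close>, the map \<open>a \<mapsto> (a ! l, C a)\<close> is a bijection from \<open>T\<close> onto a \<open>k \<times> n\<close> grid. The sign of the
  permutation sorting \<open>T\<close> by \<open>(a ! l, C a)\<close> and that of the permutation sorting \<open>T\<close> by \<open>(C a, a ! l)\<close>
  differ by the sign of the transposition of the grid, which does not depend on \<open>T\<close> and \<open>C\<close>. Multiplying
  over the odd number of directions relates the sign from sorting the wedge product to the sign of \<open>C\<close>.

  For (iii), elements of odd degree anticommute.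
\<close>

section \<open>Inversions\<close>

text \<open>A product over pairs rather than a power of -1, so that identities between signs can be
  checked one pair at a time.\<close>

definition inv_sign :: "'a::linorder set \<Rightarrow> ('a \<Rightarrow> 'b::linorder) \<Rightarrow> int" where
  "inv_sign S f = (\<Prod>(a, b)\<in>{(a, b). a \<in> S \<and> b \<in> S \<and> a < b}. if f b < f a then - 1 else 1)"

lemma finite_less_pairs [simp]: "finite S \<Longrightarrow> finite {(a, b). a \<in> S \<and> b \<in> S \<and> (a::'a::linorder) < b}"
  by (rule finite_subset[of _ "S \<times> S"]) auto

lemma prod_sign_eq_card:
  "finite A \<Longrightarrow> (\<Prod>x\<in>A. if Q x then - 1 else (1::int)) = (- 1) ^ card {x \<in> A. Q x}"
  by (simp add: prod.If_cases Int_def)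

lemma inv_sign_eq_card:
  assumes "finite S"
  shows "inv_sign S f = (- 1) ^ card {(a, b). a \<in> S \<and> b \<in> S \<and> a < b \<and> f b < f a}"
proof -
  have "inv_sign S f = (\<Prod>x\<in>{(a, b). a \<in> S \<and> b \<in> S \<and> a < b}. if f (snd x) < f (fst x) then - 1 else 1)"
    unfolding inv_sign_def by (intro prod.cong) auto
  also have "\<dots> = (- 1) ^ card {x \<in> {(a, b). a \<in> S \<and> b \<in> S \<and> a < b}. f (snd x) < f (fst x)}"
    using assms by (intro prod_sign_eq_card) simp
  also have "{x \<in> {(a, b). a \<in> S \<and> b \<in> S \<and> a < b}. f (snd x) < f (fst x)} =
      {(a, b). a \<in> S \<and> b \<in> S \<and> a < b \<and> f b < f a}" by auto
  finally show ?thesis .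
qed

lemma inv_sign_cong: "(\<And>a. a \<in> S \<Longrightarrow> f a = g a) \<Longrightarrow> inv_sign S f = inv_sign S g"
  unfolding inv_sign_def by (intro prod.cong) auto

lemma inv_sign_squared [simp]: "inv_sign S f * inv_sign S f = 1"
  unfolding inv_sign_def by (simp add: prod.distrib[symmetric] case_prod_beta prod.neutral)

text \<open>Positions in a strictly sorted list correspond to its elements in an order-preserving
  way. Passing from positions to elements makes it possible to split a set into slices or fibres
  without reindexing words.\<close>

lemma msgn_map_sorted:
  assumes xs: "sorted_wrt (<) xs"
  shows "msgn (map f xs) = inv_sign (set xs) f"
proof -
  let ?I = "{(i, j). i < j \<and> j < length xs \<and> f (xs ! j) < f (xs ! i)}"
  have inj: "xs ! i = xs ! j \<longleftrightarrow> i = j" if "i < length xs" "j < length xs" for i j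
    using xs that by (simp add: strict_sorted_iff nth_eq_iff_index_eq)
  have less: "xs ! i < xs ! j \<longleftrightarrow> i < j" if "i < length xs" "j < length xs" for i j
    using sorted_wrt_nth_less[OF xs, of i j] sorted_wrt_nth_less[OF xs, of j i] that
    by (metis linorder_neqE_nat order.asym order.irrefl)
  have "bij_betw (\<lambda>(i, j). (xs ! i, xs ! j)) ?I
      {(a, b). a \<in> set xs \<and> b \<in> set xs \<and> a < b \<and> f b < f a}"
  proof (rule bij_betw_imageI)
    show "inj_on (\<lambda>(i, j). (xs ! i, xs ! j)) ?I"
      by (auto simp: inj_on_def inj)
    show "(\<lambda>(i, j). (xs ! i, xs ! j)) ` ?I =
        {(a, b). a \<in> set xs \<and> b \<in> set xs \<and> a < b \<and> f b < f a}" (is "_ = ?R")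
    proof
      show "(\<lambda>(i, j). (xs ! i, xs ! j)) ` ?I \<subseteq> ?R" by (auto simp: less)
      show "?R \<subseteq> (\<lambda>(i, j). (xs ! i, xs ! j)) ` ?I"
        by (auto simp: in_set_conv_nth less image_iff)
    qed
  qed
  then have "card ?I = card {(a, b). a \<in> set xs \<and> b \<in> set xs \<and> a < b \<and> f b < f a}"
    by (rule bij_betw_same_card)
  moreover have "{(i, j). i < j \<and> j < length (map f xs) \<and> map f xs ! j < map f xs ! i} = ?I"
    by auto
  ultimately show ?thesis by (simp add: msgn_def inv_sign_eq_card)
qed

text \<open>Every transposition of two points is a product of adjacent ones
  (\<open>adj_transp_seq\<close>). Adjacent steps are the ones wanted here because raising operators
  relate only the neighbouring entries \<open>i\<close> and \<open>i + 1\<close>.\<close>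

lemma permutes_adjacent_induct [consumes 1, case_names id swap]:
  fixes k :: nat
  assumes "p permutes {1..k}" "P id"
    and swap: "\<And>i p. 1 \<le> i \<Longrightarrow> i < k \<Longrightarrow> p permutes {1..k} \<Longrightarrow> P p \<Longrightarrow>
      P (transpose i (i + 1) \<circ> p)"
  shows "P p"
  using assms(1) finite_atLeastAtMost[of 1 k]
proof (induction rule: permutes_induct)
  case id
  show ?case by (fact assms)
next
  case (swap a b p)
  have adj: "P (apply_adj_transps xs \<circ> p)" if "set xs \<subseteq> {1..<k}" for xs
    using that
  proof (induction xs)
    case (Cons x xs)
    then have "apply_adj_transps xs \<circ> p permutes {1..k}"
      using swap.hyps by (intro permutes_compose permutes_apply_adj_transps) auto
    with Cons assms(3)[of x "apply_adj_transps xs \<circ> p"] show ?case by (simp add: comp_def)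
  qed (simp add: swap)
  have "P (transpose a b \<circ> p)" if "a < b" "a \<in> {1..k}" "b \<in> {1..k}" for a b
    using adj[of "adj_transp_seq a b"] that by (auto simp: adj_transp_seq_correct set_adj_transp_seq)
  then show ?case
    using swap.hyps by (metis linorder_neqE_nat transpose_commute)
qed

text \<open>Exchanging the values \<open>i\<close> and \<open>i + 1\<close> changes the relative
  order of just one pair of arguments, namely the preimages of these two values.\<close>

lemma inv_sign_transpose:
  fixes k :: nat
  assumes p: "p permutes {1..k}" and i: "1 \<le> i" "i < k"
  shows "inv_sign {1..k} (transpose i (i + 1) \<circ> p) = - inv_sign {1..k} p"
proof -
  let ?\<tau> = "transpose i (i + 1)"
  let ?L = "{(a, b). a \<in> {1..k} \<and> b \<in> {1..k} \<and> a < b}"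
  let ?s = "\<lambda>p. \<lambda>(a, b). if p b < p a then - 1 else (1::int)"
  define x y where "x = inv p i" and "y = inv p (i + 1)"
  have pxy: "p x = i" "p y = i + 1"
    unfolding x_def y_def using p by (simp_all add: permutes_inverses)
  have "p x \<in> {1..k}" "p y \<in> {1..k}" "p x \<noteq> p y" using i pxy by auto
  then have xy: "x \<in> {1..k}" "y \<in> {1..k}" "x \<noteq> y"
    by (auto simp only: permutes_in_image[OF p])
  have inj: "p a = p b \<longleftrightarrow> a = b" for a b
    using permutes_inj[OF p] by (auto dest: injD)
  \<comment> \<open>The exceptional pair, written in increasing order because the product runs over
    pairs with \<open>a < b\<close>.\<close>
  let ?q = "(min x y, max x y)"
  have q: "?q \<in> ?L" using xy by (auto simp: min_def max_def)
  have other: "?s (?\<tau> \<circ> p) z = ?s p z" if z: "z \<in> ?L - {?q}" for z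
  proof -
    obtain a b where ab: "z = (a, b)" "a < b" using z by auto
    have "p a \<noteq> p b" using ab inj by simp
    moreover have "p c = i \<longleftrightarrow> c = x" "p c = i + 1 \<longleftrightarrow> c = y" for c
      using inj[of c x] inj[of c y] pxy by simp_all
    then have "\<not> (p a = i \<and> p b = i + 1)" "\<not> (p b = i \<and> p a = i + 1)"
      using z ab by (auto simp: min_def max_def)
    ultimately show ?thesis by (auto simp: ab transpose_def)
  qed
  have one: "?s (?\<tau> \<circ> p) ?q = - ?s p ?q"
    using pxy xy by (auto simp: min_def max_def)
  have rest: "prod (?s (?\<tau> \<circ> p)) (?L - {?q}) = prod (?s p) (?L - {?q})"
    by (rule prod.cong[OF refl other])
  have fin: "finite ?L" by (intro finite_less_pairs) simp
  have "inv_sign {1..k} (?\<tau> \<circ> p) = prod (?s (?\<tau> \<circ> p)) ?L" by (simp add: inv_sign_def)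
  also have "\<dots> = ?s (?\<tau> \<circ> p) ?q * prod (?s (?\<tau> \<circ> p)) (?L - {?q})"
    by (rule prod.remove[OF fin q])
  also have "\<dots> = - (?s p ?q * prod (?s p) (?L - {?q}))"
    unfolding one rest by simp
  also have "?s p ?q * prod (?s p) (?L - {?q}) = prod (?s p) ?L"
    by (rule prod.remove[OF fin q, symmetric])
  finally show ?thesis by (simp add: inv_sign_def)
qed

lemma inv_sign_permutation:
  fixes k :: nat
  assumes "p permutes {1..k}"
  shows "inv_sign {1..k} p = sign p"
  using assms
proof (induction rule: permutes_adjacent_induct)
  case id
  show ?case unfolding inv_sign_def by (auto intro!: prod.neutral)
next
  case (swap i p)
  moreover have "sign (transpose i (i + 1) \<circ> p) = - sign p"
    using swap permutes_imp_permutation[of "{1..k}" p]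
    by (subst sign_compose) (simp_all add: permutation_swap_id sign_swap_id)
  ultimately show ?case
    using inv_sign_transpose[of p k i] by (simp add: comp_def)
qed

lemma word_sign_eq_msgn:
  assumes "w \<in> permutations_of_set {1..n}"
  shows "word_sign w = msgn w"
proof -
  have w: "set w = {1..n}" "distinct w" using assms by (auto simp: permutations_of_set_def)
  then have len: "length w = n" using distinct_card[of w] by simp
  let ?s = "\<lambda>i. if i \<in> {1..length w} then w ! (i - 1) else i"
  have map: "map ?s [1..<Suc n] = w"
    by (rule nth_equalityI) (auto simp: len simp del: upt_Suc)
  have "?s permutes {1..n}"
  proof (rule inj_imp_permutes)
    show "inj_on ?s {1..n}"
      using w len by (auto simp: inj_on_def nth_eq_iff_index_eq)
    show "?s i \<in> {1..n}" if "i \<in> {1..n}" for i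
      using that len nth_mem[of "i - 1" w] w(1) by auto
  qed (auto simp: len)
  from inv_sign_permutation[OF this] have "word_sign w = inv_sign {1..n} ?s"
    by (simp add: word_sign_def)
  also have "\<dots> = msgn (map ?s [1..<Suc n])"
    by (subst msgn_map_sorted) (auto simp: atLeastLessThanSuc_atLeastAtMost simp del: upt_Suc)
  finally show ?thesis by (simp only: map)
qed

text \<open>For finite \<open>I\<close> and \<open>J\<close> this is the sign of the permutation
  that turns the row-by-row reading of the grid into the column-by-column reading.\<close>

definition grid_sign :: "'a::linorder set \<Rightarrow> 'b::linorder set \<Rightarrow> int" where
  "grid_sign I J = (- 1) ^ card {((i, c), (j, e)). i \<in> I \<and> c \<in> J \<and> j \<in> I \<and> e \<in> J \<and> i < j \<and> e < c}"

text \<open>Each pair of elements lies in at most one common fibre, so the inversions of the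
  separate fibres merge into one product over all pairs of \<open>T\<close>.\<close>

lemma prod_fiber_inv_sign:
  assumes "finite T" "finite I" "f ` T \<subseteq> I"
  shows "(\<Prod>i\<in>I. inv_sign {a \<in> T. f a = i} g) =
    (\<Prod>(a, b)\<in>{(a, b). a \<in> T \<and> b \<in> T \<and> a < b}. if f a = f b \<and> g b < g a then - 1 else 1)"
proof -
  let ?L = "{(a, b). a \<in> T \<and> b \<in> T \<and> a < b}"
  have "inv_sign {a \<in> T. f a = i} g =
      (\<Prod>(a, b)\<in>?L. if f a = i \<and> f b = i \<and> g b < g a then - 1 else 1)" for i
    unfolding inv_sign_def using assms(1)
    by (intro prod.mono_neutral_cong_left) (auto split: if_splits)
  then have "(\<Prod>i\<in>I. inv_sign {a \<in> T. f a = i} g) =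
      (\<Prod>i\<in>I. \<Prod>(a, b)\<in>?L. if f a = i \<and> f b = i \<and> g b < g a then - 1 else 1)" by simp
  also have "\<dots> = (\<Prod>z\<in>?L. \<Prod>i\<in>I. case z of (a, b) \<Rightarrow>
      if f a = i \<and> f b = i \<and> g b < g a then - 1 else 1)"
    by (rule prod.swap)
  also have "\<dots> = (\<Prod>(a, b)\<in>?L. if f a = f b \<and> g b < g a then - 1 else 1)"
  proof (intro prod.cong refl)
    fix z assume "z \<in> ?L"
    then obtain a b where z: "z = (a, b)" "a \<in> T" "b \<in> T" by auto
    \<comment> \<open>For a fixed pair, only the index \<open>i = f a\<close> can give a factor
      other than 1.\<close>
    have "(\<Prod>i\<in>I. if f a = i \<and> f b = i \<and> g b < g a then - 1 else (1::int)) =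
        (\<Prod>i\<in>I. if i = f a then (if f a = f b \<and> g b < g a then - 1 else 1) else 1)"
      by (intro prod.cong) auto
    then show "(\<Prod>i\<in>I. case z of (a, b) \<Rightarrow> if f a = i \<and> f b = i \<and> g b < g a then - 1 else 1) =
        (case z of (a, b) \<Rightarrow> if f a = f b \<and> g b < g a then - 1 else (1::int))"
      using z assms by (auto simp: image_subset_iff)
  qed
  finally show ?thesis .
qed

text \<open>
  The two orderings of \<open>T\<close>, by \<open>(f, g)\<close> and by \<open>(g, f)\<close>, disagree exactly on the pairs where
  \<open>f\<close> and \<open>g\<close> are strictly opposed; the number of these pairs only depends on the grid.
\<close>

lemma inv_sign_grid:
  assumes T: "finite T" and IJ: "finite I" "finite J"
    and bij: "bij_betw (\<lambda>a. (f a, g a)) T (I \<times> J)"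
  shows "inv_sign T f * (\<Prod>i\<in>I. inv_sign {a \<in> T. f a = i} g) =
    grid_sign I J * (inv_sign T g * (\<Prod>j\<in>J. inv_sign {a \<in> T. g a = j} f))"
proof -
  let ?L = "{(a, b). a \<in> T \<and> b \<in> T \<and> a < b}"
  let ?D = "\<lambda>(a, b). (f a < f b \<and> g b < g a) \<or> (f b < f a \<and> g a < g b)"
  let ?G = "{((i, c), (j, e)). i \<in> I \<and> c \<in> J \<and> j \<in> I \<and> e \<in> J \<and> i < j \<and> e < c}"
  let ?H = "{(a, b). a \<in> T \<and> b \<in> T \<and> f a < f b \<and> g b < g a}"
  have img: "(\<lambda>a. (f a, g a)) ` T = I \<times> J" and inj: "inj_on (\<lambda>a. (f a, g a)) T"
    using bij by (auto simp: bij_betw_def)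
  have mem: "f a \<in> I" "g a \<in> J" if "a \<in> T" for a
    using img that by blast+
  have eq: "a = b" if "a \<in> T" "b \<in> T" "f a = f b" "g a = g b" for a b
    using inj that by (auto simp: inj_on_def)
  have less: "b < a" if "f a < f b" "\<not> a < b" for a b
    using that by (metis linorder_neqE order.irrefl)
  \<comment> \<open>Opposed pairs are reoriented: first listed by the order of \<open>T\<close>,
    then by increasing \<open>f\<close>. In the second form \<open>b2\<close> sends them to pairs of
    grid points.\<close>
  have b1: "bij_betw (\<lambda>(a, b). if f a < f b then (a, b) else (b, a)) {z \<in> ?L. ?D z} ?H"
    by (rule bij_betw_byWitness[where f' = "\<lambda>(a, b). if a < b then (a, b) else (b, a)"],
        auto split: if_splits) (metis less)
  have b2: "bij_betw (\<lambda>(a, b). ((f a, g a), (f b, g b))) ?H ?G"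
  proof (rule bij_betw_imageI)
    show "inj_on (\<lambda>(a, b). ((f a, g a), (f b, g b))) ?H"
      by (auto simp: inj_on_def intro: eq)
    show "(\<lambda>(a, b). ((f a, g a), (f b, g b))) ` ?H = ?G"
    proof (intro equalityI subsetI)
      fix z assume "z \<in> ?G"
      then obtain i c j e where z: "z = ((i, c), (j, e))" "(i, c) \<in> I \<times> J" "(j, e) \<in> I \<times> J"
        "i < j" "e < c" by auto
      from z(2) obtain a where "a \<in> T" "(i, c) = (f a, g a)" unfolding img[symmetric] by auto
      moreover from z(3) obtain b where "b \<in> T" "(j, e) = (f b, g b)" unfolding img[symmetric] by auto
      ultimately show "z \<in> (\<lambda>(a, b). ((f a, g a), (f b, g b))) ` ?H"
        using z by (intro image_eqI[of _ _ "(a, b)"]) auto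
    qed (auto simp: mem)
  qed
  have card: "card {z \<in> ?L. ?D z} = card ?G"
    by (rule trans[OF bij_betw_same_card[OF b1] bij_betw_same_card[OF b2]])
  have D: "(\<Prod>z\<in>?L. if ?D z then - 1 else 1) = grid_sign I J"
    unfolding grid_sign_def card[symmetric] using T by (intro prod_sign_eq_card) simp
  have "f ` T \<subseteq> I" "g ` T \<subseteq> J" using mem by auto
  note fiber = prod_fiber_inv_sign[OF T IJ(1) this(1)] prod_fiber_inv_sign[OF T IJ(2) this(2)]
  \<comment> \<open>The left side is the contribution of a pair to sorting by \<open>(f, g)\<close>,
    the right side its contribution to sorting by \<open>(g, f)\<close>, corrected when
    \<open>f\<close> and \<open>g\<close> are strictly opposed.\<close>
  have pt: "(if f b < f a then - 1 else 1) * (if f a = f b \<and> g b < g a then - 1 else 1) =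
      (if f a < f b \<and> g b < g a \<or> f b < f a \<and> g a < g b then - 1 else 1) *
      ((if g b < g a then - 1 else 1) * (if g a = g b \<and> f b < f a then - 1 else (1::int)))" for a b
    by (cases "f a" "f b" rule: linorder_cases; cases "g a" "g b" rule: linorder_cases)
      (auto dest: order.asym)
  show ?thesis
    unfolding fiber D[symmetric] unfolding inv_sign_def prod.distrib[symmetric]
  proof (intro prod.cong refl)
    fix z :: "'a \<times> 'a"
    obtain a b where "z = (a, b)" by force
    then show "(case z of (a, b) \<Rightarrow> if f b < f a then - 1 else 1) *
        (case z of (a, b) \<Rightarrow> if f a = f b \<and> g b < g a then - 1 else 1) =
        (if ?D z then - 1 else 1) * ((case z of (a, b) \<Rightarrow> if g b < g a then - 1 else 1) *
        (case z of (a, b) \<Rightarrow> if g a = g b \<and> f b < f a then - 1 else (1::int)))"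
      by (simp only: prod.case pt)
  qed
qed

section \<open>Magic sets and diagonals\<close>

lemma slice_subset_cells: "slice d k l i \<subseteq> cells d k"
  by (auto simp: slice_def)

lemma finite_slice [simp]: "finite (slice d k l i)"
  by (rule finite_subset[OF slice_subset_cells finite_cells])

lemma cells_nth: "a \<in> cells d k \<Longrightarrow> l < d \<Longrightarrow> a ! l \<in> {1..k}"
  by (auto simp: cells_def dest!: nth_mem[of l a])

lemma card_eq_sum_slices:
  assumes "T \<subseteq> cells d k" "l < d"
  shows "card T = (\<Sum>i\<in>{1..k}. card (T \<inter> slice d k l i))"
proof -
  have "T = (\<Union>i\<in>{1..k}. T \<inter> slice d k l i)"
    using assms cells_nth by (fastforce simp: slice_def)
  also have "card \<dots> = (\<Sum>i\<in>{1..k}. card (T \<inter> slice d k l i))"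
    by (intro card_UN_disjoint ballI impI finite_Int disjI2 finite_slice) (auto simp: slice_def)
  finally show ?thesis .
qed

text \<open>Each direction partitions \<open>T\<close> into \<open>k\<close> slices of the same
  size, so this size has to be \<open>card T\<close> divided by \<open>k\<close>.\<close>

lemma magic_card_iff:
  assumes "0 < d" "0 < k"
  shows "magic d k T \<and> card T = n * k \<longleftrightarrow>
    T \<subseteq> cells d k \<and> (\<forall>l<d. \<forall>i\<in>{1..k}. card (T \<inter> slice d k l i) = n)"
proof
  assume m: "magic d k T \<and> card T = n * k"
  then obtain c where T: "T \<subseteq> cells d k" and c: "\<forall>l<d. \<forall>i\<in>{1..k}. card (T \<inter> slice d k l i) = c"
    by (auto simp: magic_def)
  have "n = c"
    using card_eq_sum_slices[OF T assms(1)] m c assms by simp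
  then show "T \<subseteq> cells d k \<and> (\<forall>l<d. \<forall>i\<in>{1..k}. card (T \<inter> slice d k l i) = n)"
    using T c assms by simp
next
  assume T: "T \<subseteq> cells d k \<and> (\<forall>l<d. \<forall>i\<in>{1..k}. card (T \<inter> slice d k l i) = n)"
  then have "card T = n * k"
    using card_eq_sum_slices[of T d k 0] assms by simp
  with T show "magic d k T \<and> card T = n * k" by (auto simp: magic_def)
qed

section \<open>Diagonals and their description by permutations\<close>

definition diagonal :: "nat \<Rightarrow> nat \<Rightarrow> nat list set \<Rightarrow> bool" where
  "diagonal d k T \<longleftrightarrow> magic d k T \<and> card T = k"

lemma diagonal_iff:
  assumes "0 < d" "0 < k"
  shows "diagonal d k T \<longleftrightarrow>
    T \<subseteq> cells d k \<and> (\<forall>l<d. \<forall>i\<in>{1..k}. card (T \<inter> slice d k l i) = 1)"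
  using magic_card_iff[OF assms, of T 1] by (simp add: diagonal_def)

lemma diagonal_finite: "diagonal d k T \<Longrightarrow> finite T"
  by (auto simp: diagonal_def magic_def intro: finite_subset[OF _ finite_cells])

text \<open>The cells of a diagonal are numbered by \<open>j\<close>, and \<open>p l\<close> gives
  their coordinates in direction \<open>l\<close>. Under the normalisation \<open>p 0 = id\<close>
  the numbering agrees with the lexicographic order.\<close>

definition diag_cell :: "nat \<Rightarrow> (nat \<Rightarrow> nat \<Rightarrow> nat) \<Rightarrow> nat \<Rightarrow> nat list" where
  "diag_cell d p j = map (\<lambda>l. p l j) [0..<d]"

lemma length_diag_cell [simp]: "length (diag_cell d p j) = d"
  and nth_diag_cell [simp]: "l < d \<Longrightarrow> diag_cell d p j ! l = p l j"
  by (simp_all add: diag_cell_def)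

definition perm_tuple :: "nat \<Rightarrow> nat \<Rightarrow> (nat \<Rightarrow> nat \<Rightarrow> nat) \<Rightarrow> bool" where
  "perm_tuple d k p \<longleftrightarrow> (\<forall>l<d. p l permutes {1..k})"

lemma diag_cell_in_cells:
  "perm_tuple d k p \<Longrightarrow> j \<in> {1..k} \<Longrightarrow> diag_cell d p j \<in> cells d k"
  using permutes_in_image by (fastforce simp: cells_def diag_cell_def perm_tuple_def)

lemma diagonal_diag_cell:
  assumes "0 < d" "0 < k" "perm_tuple d k p"
  shows "diagonal d k (diag_cell d p ` {1..k})"
proof -
  have "card (diag_cell d p ` {1..k} \<inter> slice d k l i) = 1" if l: "l < d" and i: "i \<in> {1..k}" for l i
  proof -
    have p: "p l permutes {1..k}" using assms l by (simp add: perm_tuple_def)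
    let ?j = "inv (p l) i"
    have j: "?j \<in> {1..k}" using permutes_in_image[OF permutes_inv[OF p]] i by blast
    have "diag_cell d p j \<in> slice d k l i \<longleftrightarrow> j = ?j" if "j \<in> {1..k}" for j
      using that l diag_cell_in_cells[OF assms(3) that] permutes_inv_eq[OF p, of i j]
      by (auto simp: slice_def)
    then have "diag_cell d p ` {1..k} \<inter> slice d k l i = {diag_cell d p ?j}" using j by auto
    then show ?thesis by simp
  qed
  then show ?thesis
    using assms diag_cell_in_cells[OF assms(3)] by (auto simp: diagonal_iff)
qed

text \<open>Numbering the cells by their coordinate in direction 0 gives \<open>p 0 = id\<close>. A
  coordinate in another direction is injective in this number because each slice contains only one
  cell.\<close>

lemma diagonal_obtain:
  assumes "0 < d" "0 < k" "diagonal d k T"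
  obtains p where "perm_tuple d k p" "p 0 = id" "T = diag_cell d p ` {1..k}"
proof -
  have T: "T \<subseteq> cells d k" "\<And>l i. l < d \<Longrightarrow> i \<in> {1..k} \<Longrightarrow> card (T \<inter> slice d k l i) = 1"
    using assms by (auto simp: diagonal_iff)
  have "\<exists>x. T \<inter> slice d k 0 i = {x}" if "i \<in> {1..k}" for i
    using T(2)[OF assms(1) that] by (rule card_1_singletonE) blast
  then obtain x where x: "\<And>i. i \<in> {1..k} \<Longrightarrow> T \<inter> slice d k 0 i = {x i}" by metis
  have xT: "x i \<in> T" "x i ! 0 = i" if "i \<in> {1..k}" for i
    using x[OF that] by (auto simp: slice_def)
  have Tx: "a = x (a ! 0)" "a ! 0 \<in> {1..k}" if "a \<in> T" for a
    using x[of "a ! 0"] cells_nth[of a d k 0] that T(1) assms(1) by (auto simp: slice_def)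
  \<comment> \<open>Outside \<open>{1..k}\<close> the map is the identity, as
    \<open>permutes\<close> demands.\<close>
  define p where "p l i = (if i \<in> {1..k} then x i ! l else i)" for l i
  have "p l permutes {1..k}" if l: "l < d" for l
  proof (rule inj_imp_permutes)
    show "inj_on (p l) {1..k}"
    proof (rule inj_onI)
      fix i j assume ij: "i \<in> {1..k}" "j \<in> {1..k}" "p l i = p l j"
      then have "x i ! l = x j ! l" by (simp add: p_def)
      moreover have "x i \<in> cells d k" "x j \<in> cells d k" using ij xT T(1) by auto
      ultimately have "{x i, x j} \<subseteq> T \<inter> slice d k l (x i ! l)"
        using ij xT by (auto simp: slice_def)
      moreover obtain z where "T \<inter> slice d k l (x i ! l) = {z}"
        using T(2)[OF l] cells_nth[OF \<open>x i \<in> cells d k\<close> l] by (meson card_1_singletonE)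
      ultimately have "x i = x j" by simp
      then show "i = j" using xT ij by metis
    qed
    show "p l i \<in> {1..k}" if i: "i \<in> {1..k}" for i
      using cells_nth[of "x i" d k l] xT(1)[OF i] T(1) l i unfolding p_def by auto
  qed (auto simp: p_def)
  then have "perm_tuple d k p" by (simp add: perm_tuple_def)
  moreover have "p 0 = id" using xT(2) by (auto simp: p_def fun_eq_iff)
  moreover have "T = diag_cell d p ` {1..k}"
  proof -
    have "diag_cell d p i = x i" if "i \<in> {1..k}" for i
      using that xT(1)[OF that] T(1) by (intro nth_equalityI) (auto simp: cells_def p_def)
    then have "diag_cell d p ` {1..k} = x ` {1..k}" by simp
    also have "\<dots> = T"
    proof
      show "x ` {1..k} \<subseteq> T" using xT by auto
      show "T \<subseteq> x ` {1..k}" using Tx by blast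
    qed
    finally show ?thesis ..
  qed
  ultimately show ?thesis by (rule that)
qed

section \<open>The terms of omega as wedge products over diagonals\<close>

definition wedge :: "nat \<Rightarrow> (nat \<Rightarrow> 'b::linorder) \<Rightarrow> 'b exterior" where
  "wedge k g = prod_list (map (\<lambda>j. gen (g j)) [1..<k + 1])"

lemma sorted_diag_cells:
  assumes "0 < d" "p 0 = id"
  shows "sorted_wrt (<) (map (diag_cell d p) [1..<k + 1])"
  unfolding sorted_wrt_map
proof (rule sorted_wrt_mono_rel[of _ "(<)"])
  fix i j :: nat assume "i < j"
  moreover have "[0..<d] = 0 # [1..<d]" using assms by (simp add: upt_conv_Cons)
  ultimately show "diag_cell d p i < diag_cell d p j" using assms by (simp add: diag_cell_def)
qed (rule sorted_wrt_upt)

lemma set_diag_cells: "set (map g [1..<k + 1]) = g ` {1..k}"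
  by (auto simp: image_iff)

lemma sorted_list_of_set_eqI: "sorted_wrt (<) xs \<Longrightarrow> sorted_list_of_set (set xs) = xs"
  by (metis sorted_list_of_set.idem_if_sorted_distinct strict_sorted_iff)

lemma sorted_list_diag_cells:
  assumes "0 < d" "p 0 = id"
  shows "sorted_list_of_set (diag_cell d p ` {1..k}) = map (diag_cell d p) [1..<k + 1]"
  using sorted_list_of_set_eqI[OF sorted_diag_cells[where p = p and d = d, OF assms, of k]] by (simp only: set_diag_cells)

lemma wedge_diag_cell:
  assumes "0 < d" "p 0 = id"
  shows "wedge k (diag_cell d p) = psi (diag_cell d p ` {1..k})"
  unfolding psi_def sorted_list_diag_cells[where p = p and d = d, OF assms] by (simp add: wedge_def comp_def)

text \<open>In lexicographic order the cells are those for \<open>j = 1, ..., k\<close>, so their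
  coordinates in direction \<open>l\<close> spell out \<open>p l\<close>, whose inversions give its
  sign.\<close>

lemma set_sign_diag_cell:
  assumes "0 < d" "p 0 = id" "perm_tuple d k p"
  shows "set_sign d (diag_cell d p ` {1..k}) = (\<Prod>l<d. sign (p l))"
  unfolding set_sign_def
proof (intro prod.cong refl)
  fix l assume "l \<in> {..<d}"
  then have l: "l < d" "p l permutes {1..k}" using assms by (auto simp: perm_tuple_def)
  have "map (\<lambda>a. a ! l) (sorted_list_of_set (diag_cell d p ` {1..k})) = map (p l) [1..<k + 1]"
    unfolding sorted_list_diag_cells[where p = p and d = d, OF assms(1,2)] using l by simp
  also have "msgn \<dots> = inv_sign {1..k} (p l)"
    by (subst msgn_map_sorted) (auto simp: atLeastLessThanSuc_atLeastAtMost simp del: upt_Suc)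
  also have "\<dots> = sign (p l)" using l by (intro inv_sign_permutation)
  finally show "msgn (map (\<lambda>a. a ! l) (sorted_list_of_set (diag_cell d p ` {1..k}))) = sign (p l)" .
qed

text \<open>These functions are \<open>undefined\<close> at direction 0; the full tuple of
  permutations is therefore always \<open>p(0 := id)\<close>.\<close>

definition omega_index :: "nat \<Rightarrow> nat \<Rightarrow> (nat \<Rightarrow> nat \<Rightarrow> nat) set" where
  "omega_index d k = {1..<d} \<rightarrow>\<^sub>E {\<pi>. \<pi> permutes {1..k}}"

lemma finite_omega_index [simp]: "finite (omega_index d k)"
  unfolding omega_index_def by (intro finite_PiE) (simp_all add: finite_permutations)

lemma perm_tuple_omega_index:
  "p \<in> omega_index d k \<Longrightarrow> perm_tuple d k (p(0 := id))"
  by (auto simp: omega_index_def perm_tuple_def PiE_iff permutes_id)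

lemma sign_foldr_comp:
  "\<forall>\<pi>\<in>set ps. permutation \<pi> \<Longrightarrow> permutation (foldr (\<circ>) ps id) \<and>
    sign (foldr (\<circ>) ps id) = prod_list (map sign ps)"
  by (induction ps) (auto simp: sign_compose permutation_compose)

lemma omega_eq_wedges:
  assumes "0 < d"
  shows "omega d k = (\<Sum>p\<in>omega_index d k.
    scale (of_int (\<Prod>l\<in>{1..<d}. sign (p l))) (wedge k (diag_cell d (p(0 := id)))))"
  unfolding omega_def omega_index_def[symmetric]
proof (intro sum.cong refl)
  fix p assume p: "p \<in> omega_index d k"
  let ?q = "p(0 := id)"
  have perm: "\<forall>\<pi>\<in>set (map p [1..<d]). permutation \<pi>"
    using p by (auto simp: omega_index_def PiE_iff intro!: permutes_imp_permutation[of "{1..k}"])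
  have "sign (foldr (\<circ>) (map p [1..<d]) id) = (\<Prod>l\<in>{1..<d}. sign (p l))"
    using sign_foldr_comp[OF perm] by (simp add: prod.distinct_set_conv_list[symmetric] comp_def)
  moreover have "tensor k (std i # map (\<lambda>j. std (p j i)) [1..<d]) = gen (diag_cell d ?q i)"
    if "i \<in> {1..k}" for i
  proof -
    have "[0..<d] = 0 # [1..<d]" using assms by (simp add: upt_conv_Cons)
    then have "std i # map (\<lambda>j. std (p j i)) [1..<d] = map std (diag_cell d ?q i)"
      by (simp add: diag_cell_def)
    then show ?thesis
      using tensor_std[OF diag_cell_in_cells[OF perm_tuple_omega_index[OF p] that]] by simp
  qed
  then have "map (\<lambda>i. tensor k (std i # map (\<lambda>j. std (p j i)) [1..<d])) [1..<k + 1] =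
      map (\<lambda>i. gen (diag_cell d ?q i)) [1..<k + 1]"
    by (intro map_cong refl) auto
  ultimately show "scale (of_int (sign (foldr (\<circ>) (map p [1..<d]) id)))
      (prod_list (map (\<lambda>i. tensor k (std i # map (\<lambda>j. std (p j i)) [1..<d])) [1..<k + 1])) =
      scale (of_int (\<Prod>l\<in>{1..<d}. sign (p l))) (wedge k (diag_cell d ?q))"
    by (simp only: wedge_def)
qed

text \<open>The sorted list of a diagonal recovers its cells together with their numbering, and
  hence all permutations.\<close>

lemma inj_omega_index:
  assumes "0 < d"
  shows "inj_on (\<lambda>p. diag_cell d (p(0 := id)) ` {1..k}) (omega_index d k)"
proof (rule inj_onI)
  fix p q assume p: "p \<in> omega_index d k" and q: "q \<in> omega_index d k"
    and eq: "diag_cell d (p(0 := id)) ` {1..k} = diag_cell d (q(0 := id)) ` {1..k}"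
  then have "map (diag_cell d (p(0 := id))) [1..<k + 1] = map (diag_cell d (q(0 := id))) [1..<k + 1]"
    using sorted_list_diag_cells[OF assms, of "p(0 := id)" k]
      sorted_list_diag_cells[OF assms, of "q(0 := id)" k] by simp
  then have cell: "diag_cell d (p(0 := id)) i = diag_cell d (q(0 := id)) i" if "i \<in> {1..k}" for i
    using that by (simp del: upt_Suc)
  show "p = q"
  proof (rule PiE_ext)
    show "p \<in> {1..<d} \<rightarrow>\<^sub>E {\<pi>. \<pi> permutes {1..k}}" "q \<in> {1..<d} \<rightarrow>\<^sub>E {\<pi>. \<pi> permutes {1..k}}"
      using p q by (simp_all add: omega_index_def)
    fix l assume l: "l \<in> {1..<d}"
    show "p l = q l"
    proof
      fix i
      show "p l i = q l i"
      proof (cases "i \<in> {1..k}")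
        case True
        from cell[OF True] have "diag_cell d (p(0 := id)) i ! l = diag_cell d (q(0 := id)) i ! l"
          by simp
        then show ?thesis using l by simp
      next
        case False
        have "p l permutes {1..k}" "q l permutes {1..k}"
          using p q l by (auto simp: omega_index_def PiE_iff)
        then show ?thesis using False by (simp add: permutes_not_in)
      qed
    qed
  qed
qed

text \<open>Different index tuples give different diagonals and every diagonal occurs, so no two
  terms of \<open>omega\<close> meet. Direction 0 contributes the sign of \<open>id\<close>, which
  is 1.\<close>

lemma coeff_omega:
  assumes "0 < d" "0 < k"
  shows "coeff (omega d k) T = (if diagonal d k T then of_int (set_sign d T) else 0)"
proof -
  let ?D = "\<lambda>p. diag_cell d (p(0 := id)) ` {1..k}"
  let ?c = "\<lambda>p. of_int (\<Prod>l\<in>{1..<d}. sign (p l)) :: complex"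
  have sgn: "set_sign d (?D p) = (\<Prod>l\<in>{1..<d}. sign (p l))" if "p \<in> omega_index d k" for p
  proof -
    have "{..<d} = insert 0 {1..<d}" using assms by auto
    then show ?thesis
      using set_sign_diag_cell[OF assms(1) _ perm_tuple_omega_index[OF that]] by simp
  qed
  have "coeff (omega d k) T = (\<Sum>p\<in>omega_index d k. ?c p * coeff (psi (?D p)) T)"
    by (simp add: omega_eq_wedges[OF assms(1)] wedge_diag_cell[OF assms(1)])
  also have "\<dots> = (\<Sum>p\<in>omega_index d k. if ?D p = T then of_int (set_sign d T) else 0)"
    by (intro sum.cong refl) (auto simp: coeff_psi sgn[simplified] simp del: of_int_prod)
  also have "\<dots> = (\<Sum>P\<in>?D ` omega_index d k. if P = T then of_int (set_sign d T) else 0)"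
    by (subst sum.reindex[OF inj_omega_index[OF assms(1)]]) (simp only: comp_def)
  also have "\<dots> = (if T \<in> ?D ` omega_index d k then of_int (set_sign d T) else 0)"
    by (simp add: sum.delta)
  also have "T \<in> ?D ` omega_index d k \<longleftrightarrow> diagonal d k T"
  proof
    assume "T \<in> ?D ` omega_index d k"
    then show "diagonal d k T"
      using diagonal_diag_cell[OF assms perm_tuple_omega_index] by auto
  next
    assume "diagonal d k T"
    then obtain p where p: "perm_tuple d k p" "p 0 = id" "T = diag_cell d p ` {1..k}"
      using diagonal_obtain[OF assms] by blast
    let ?p = "restrict p {1..<d}"
    have "?p \<in> omega_index d k"
      using p(1) by (auto simp: omega_index_def perm_tuple_def)
    moreover have "diag_cell d (?p(0 := id)) = diag_cell d p"
      using p(2) by (auto simp: diag_cell_def fun_eq_iff)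
    then have "?D ?p = T" by (simp add: p(3))
    ultimately show "T \<in> ?D ` omega_index d k" by blast
  qed
  finally show ?thesis .
qed

section \<open>Powers of omega\<close>

text \<open>The value \<open>m\<close> exceeds all values on \<open>A\<close>, so the new inversions
  are the pairs in which an element of \<open>T - A\<close> precedes an element of \<open>A\<close>.
  These are the pairs that \<open>shuffle_sign\<close> counts.\<close>

lemma inv_sign_extend:
  assumes "finite T" "A \<subseteq> T" "\<And>a. a \<in> A \<Longrightarrow> C' a = C a \<and> C a < m" "\<And>a. a \<in> T - A \<Longrightarrow> C' a = m"
  shows "of_int (inv_sign T C') = shuffle_sign A (T - A) * of_int (inv_sign A C)"
proof -
  let ?I = "{(a, b). a \<in> A \<and> b \<in> A \<and> a < b \<and> C b < C a}"
  let ?X = "{(a, b). a \<in> A \<and> b \<in> T - A \<and> b < a}"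
  have A: "finite A" using assms finite_subset by blast
  have fin: "finite ?I" "finite ?X"
    using A assms(1) by (auto intro: finite_subset[of _ "T \<times> T"] dest: subsetD[OF assms(2)])
  have "a \<in> T \<and> b \<in> T \<and> a < b \<and> C' b < C' a \<longleftrightarrow>
      (a, b) \<in> ?I \<union> prod.swap ` ?X" for a b
    using assms(2) assms(3)[of a] assms(3)[of b] assms(4)[of a] assms(4)[of b]
    by (cases "a \<in> A"; cases "b \<in> A") (auto simp: image_iff)
  then have "{(a, b). a \<in> T \<and> b \<in> T \<and> a < b \<and> C' b < C' a} = ?I \<union> prod.swap ` ?X" by blast
  moreover have "?I \<inter> prod.swap ` ?X = {}" by auto
  moreover have "card (prod.swap ` ?X) = card ?X" by (intro card_image) simp
  ultimately have "card {(a, b). a \<in> T \<and> b \<in> T \<and> a < b \<and> C' b < C' a} = card ?I + card ?X"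
    using fin by (simp add: card_Un_disjoint)
  then show ?thesis
    using A assms(1) by (simp add: inv_sign_eq_card shuffle_sign_def power_add)
qed

text \<open>The function \<open>C\<close> records from which factor each of the basis vectors is taken.\<close>

lemma coeff_power:
  assumes "finite T"
  shows "coeff (x ^ n) T = (\<Sum>C\<in>T \<rightarrow>\<^sub>E {1..n}.
    of_int (inv_sign T C) * (\<Prod>j\<in>{1..n}. coeff x {a \<in> T. C a = j}))"
  using assms
proof (induction n arbitrary: T)
  case 0
  show ?case
    by (cases "T = {}") (auto simp: one_exterior.rep_eq inv_sign_def PiE_eq_empty_iff)
next
  case (Suc n)
  let ?F = "\<lambda>T n C. of_int (inv_sign T C) * (\<Prod>j\<in>{1..n}. coeff x {a \<in> T. C a = j})"
  \<comment> \<open>The set \<open>A\<close> is covered by the first \<open>n\<close> factors and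
    \<open>T - A\<close> by the last one, numbered \<open>Suc n\<close>. The value
    \<open>undefined\<close> outside \<open>T\<close> keeps the function extensional.\<close>
  let ?ext = "\<lambda>(A, C) a. if a \<in> A then C a else if a \<in> T then Suc n else undefined"
  have fin: "finite A" if "A \<in> Pow T" for A using that Suc.prems finite_subset by blast
  have "coeff (x ^ Suc n) T =
      (\<Sum>A\<in>Pow T. shuffle_sign A (T - A) * coeff (x ^ n) A * coeff x (T - A))"
    by (simp only: power_Suc2 times_exterior.rep_eq)
  also have "\<dots> = (\<Sum>A\<in>Pow T. \<Sum>C\<in>A \<rightarrow>\<^sub>E {1..n}. ?F T (Suc n) (?ext (A, C)))"
  proof (intro sum.cong refl)
    fix A assume A: "A \<in> Pow T"
    have "shuffle_sign A (T - A) * ?F A n C * coeff x (T - A) = ?F T (Suc n) (?ext (A, C))"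
      if C: "C \<in> A \<rightarrow>\<^sub>E {1..n}" for C
    proof -
      have lt: "C a < Suc n" if "a \<in> A" for a using C that by (auto simp: PiE_iff less_Suc_eq_le)
      have "of_int (inv_sign T (?ext (A, C))) = shuffle_sign A (T - A) * of_int (inv_sign A C)"
        using Suc.prems A lt by (intro inv_sign_extend) auto
      moreover have "{a \<in> T. ?ext (A, C) a = j} = {a \<in> A. C a = j}" if "j \<in> {1..n}" for j
        using A that by auto
      moreover have "{a \<in> T. ?ext (A, C) a = Suc n} = T - A"
        using A by (auto dest: lt)
      ultimately show ?thesis by (simp add: atLeastAtMostSuc_conv mult_ac)
    qed
    then show "shuffle_sign A (T - A) * coeff (x ^ n) A * coeff x (T - A) =
        (\<Sum>C\<in>A \<rightarrow>\<^sub>E {1..n}. ?F T (Suc n) (?ext (A, C)))"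
      by (simp only: Suc.IH[OF fin[OF A]] sum_distrib_left sum_distrib_right cong: sum.cong)
  qed
  also have "\<dots> = (\<Sum>z\<in>Sigma (Pow T) (\<lambda>A. A \<rightarrow>\<^sub>E {1..n}). ?F T (Suc n) (?ext z))"
  proof (subst sum.Sigma)
    show "finite (Pow T)" using Suc.prems by simp
    show "\<forall>A\<in>Pow T. finite (A \<rightarrow>\<^sub>E {1..n})" using fin by (auto intro!: finite_PiE)
  qed (intro sum.cong refl, simp only: split_beta prod.collapse fst_conv snd_conv)
  also have "\<dots> = (\<Sum>C\<in>T \<rightarrow>\<^sub>E {1..Suc n}. ?F T (Suc n) C)"
  proof (rule sum.reindex_bij_witness[where j = ?ext
        and i = "\<lambda>C. ({a \<in> T. C a \<le> n}, restrict C {a \<in> T. C a \<le> n})"], goal_cases)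
    case (1 z)
    obtain A C where z: "z = (A, C)" by force
    with 1 have A: "A \<subseteq> T" and C: "C \<in> A \<rightarrow>\<^sub>E {1..n}" by auto
    have "{a \<in> T. ?ext z a \<le> n} = A" using A C by (auto simp: z PiE_iff split: if_splits)
    moreover have "restrict (?ext z) A = C" using C by (auto simp: z fun_eq_iff PiE_iff extensional_def)
    ultimately show ?case by (simp add: z)
  next
    case (2 z)
    then show ?case by (fastforce simp: PiE_iff extensional_def)
  next
    case (3 C)
    then show ?case by (auto simp: fun_eq_iff PiE_iff extensional_def le_Suc_eq)
  next
    case (4 C)
    then show ?case by (auto simp: PiE_iff)
  qed auto
  finally show ?case .
qed

section \<open>Partial Latin hypercubes as slicewise bijections\<close>

lemma bij_betw_iff_card_fibers:
  assumes "C ` S \<subseteq> J"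
  shows "bij_betw C S J \<longleftrightarrow> (\<forall>j\<in>J. card {a \<in> S. C a = j} = 1)"
proof
  assume bij: "bij_betw C S J"
  show "\<forall>j\<in>J. card {a \<in> S. C a = j} = 1"
  proof
    fix j assume "j \<in> J"
    then obtain a where "a \<in> S" "C a = j" using bij by (auto simp: bij_betw_def)
    then have "{b \<in> S. C b = j} = {a}" using bij by (auto simp: bij_betw_def inj_on_def)
    then show "card {a \<in> S. C a = j} = 1" by simp
  qed
next
  assume card: "\<forall>j\<in>J. card {a \<in> S. C a = j} = 1"
  have "inj_on C S"
  proof (rule inj_onI)
    fix a b assume ab: "a \<in> S" "b \<in> S" "C a = C b"
    then obtain c where "{a' \<in> S. C a' = C a} = {c}"
      using card assms by (meson card_1_singletonE image_subset_iff)
    then show "a = b" using ab by (metis (mono_tags, lifting) mem_Collect_eq singletonD)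
  qed
  moreover have "J \<subseteq> C ` S"
  proof
    fix j assume "j \<in> J"
    then have "{a \<in> S. C a = j} \<noteq> {}" using card by (metis card.empty zero_neq_one)
    then show "j \<in> C ` S" by auto
  qed
  ultimately show "bij_betw C S J" using assms by (auto simp: bij_betw_def)
qed

text \<open>The Latin condition without words and without the value 0. It is the common form in
  which hypercubes and decompositions into diagonals are compared.\<close>

definition slicewise_bij :: "nat \<Rightarrow> nat \<Rightarrow> nat \<Rightarrow> nat list set \<Rightarrow> (nat list \<Rightarrow> nat) \<Rightarrow> bool" where
  "slicewise_bij d k n T C \<longleftrightarrow> (\<forall>l<d. \<forall>i\<in>{1..k}. bij_betw C (T \<inter> slice d k l i) {1..n})"

text \<open>This exchanges the quantifiers over values and slices: a fibre meets a slice once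
  exactly when its value is taken once on that slice.\<close>

lemma fibers_diagonal_iff:
  assumes "0 < d" "0 < k" "C \<in> T \<rightarrow> {1..n}"
  shows "(\<forall>j\<in>{1..n}. diagonal d k {a \<in> T. C a = j}) \<longleftrightarrow> T \<subseteq> cells d k \<and> slicewise_bij d k n T C"
proof -
  have T: "T = (\<Union>j\<in>{1..n}. {a \<in> T. C a = j})" using assms by auto
  have "(\<forall>j\<in>{1..n}. diagonal d k {a \<in> T. C a = j}) \<longleftrightarrow> T \<subseteq> cells d k \<and>
      (\<forall>j\<in>{1..n}. \<forall>l<d. \<forall>i\<in>{1..k}. card ({a \<in> T. C a = j} \<inter> slice d k l i) = 1)"
    unfolding diagonal_iff[OF assms(1,2)] by (subst (2) T) blast
  also have "\<dots> \<longleftrightarrow> T \<subseteq> cells d k \<and>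
      (\<forall>l<d. \<forall>i\<in>{1..k}. \<forall>j\<in>{1..n}. card {a \<in> T \<inter> slice d k l i. C a = j} = 1)"
  proof -
    have "{a \<in> T. C a = j} \<inter> slice d k l i = {a \<in> T \<inter> slice d k l i. C a = j}" for j l i by auto
    then show ?thesis by auto
  qed
  also have "\<dots> \<longleftrightarrow> T \<subseteq> cells d k \<and> slicewise_bij d k n T C"
  proof -
    have "C ` (T \<inter> slice d k l i) \<subseteq> {1..n}" for l i using assms(3) by auto
    then show ?thesis by (simp only: slicewise_bij_def bij_betw_iff_card_fibers)
  qed
  finally show ?thesis .
qed

lemma slice_word_eq:
  assumes "\<And>a. a \<in> cells d k \<Longrightarrow> C a \<noteq> 0 \<longleftrightarrow> a \<in> T"
  shows "slice_word d k C l i = map C (sorted_list_of_set (T \<inter> slice d k l i))"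
proof -
  have "sorted_wrt (<) (filter (\<lambda>a. C a \<noteq> 0) (sorted_list_of_set (slice d k l i)))"
    by (intro sorted_wrt_filter) simp
  then have "sorted_list_of_set (set (filter (\<lambda>a. C a \<noteq> 0) (sorted_list_of_set (slice d k l i)))) =
      filter (\<lambda>a. C a \<noteq> 0) (sorted_list_of_set (slice d k l i))"
    by (rule sorted_list_of_set_eqI)
  moreover have "set (filter (\<lambda>a. C a \<noteq> 0) (sorted_list_of_set (slice d k l i))) = T \<inter> slice d k l i"
    using assms by (auto simp: slice_def finite_slice[unfolded slice_def])
  ultimately show ?thesis by (simp add: slice_word_def filter_map comp_def)
qed

lemma map_sorted_permutation_iff:
  assumes "finite S"
  shows "map C (sorted_list_of_set S) \<in> permutations_of_set J \<longleftrightarrow> bij_betw C S J"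
  using assms by (auto simp: permutations_of_set_def distinct_map bij_betw_def)

lemma partial_latin_hypercubes_iff:
  "C \<in> partial_latin_hypercubes d k n T \<longleftrightarrow> C \<in> cells d k \<rightarrow>\<^sub>E {0..n} \<and>
    (\<forall>a\<in>cells d k. C a \<noteq> 0 \<longleftrightarrow> a \<in> T) \<and> slicewise_bij d k n T C"
proof -
  have "slice_word d k C l i \<in> permutations_of_set {1..n} \<longleftrightarrow>
      bij_betw C (T \<inter> slice d k l i) {1..n}" if "\<forall>a\<in>cells d k. C a \<noteq> 0 \<longleftrightarrow> a \<in> T" for l i
    using that slice_word_eq[of d k C T l i] by (simp add: map_sorted_permutation_iff)
  then show ?thesis
    unfolding partial_latin_hypercubes_def slicewise_bij_def by auto
qed

lemma slicewise_bij_cong: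
  assumes "\<And>a. a \<in> T \<Longrightarrow> C a = D a"
  shows "slicewise_bij d k n T C \<longleftrightarrow> slicewise_bij d k n T D"
proof -
  have "bij_betw C (T \<inter> slice d k l i) {1..n} \<longleftrightarrow> bij_betw D (T \<inter> slice d k l i) {1..n}" for l i
    using assms by (intro bij_betw_cong) auto
  then show ?thesis by (simp only: slicewise_bij_def)
qed

text \<open>Hypercubes are functions on all cells that vanish off \<open>T\<close>, while
  \<open>coeff_power\<close> sums over extensional functions on \<open>T\<close>. Extension by 0 and
  restriction to \<open>T\<close> are mutually inverse.\<close>

lemma sum_partial_latin_hypercubes:
  assumes T: "T \<subseteq> cells d k" and g: "\<And>C D. (\<And>a. a \<in> T \<Longrightarrow> C a = D a) \<Longrightarrow> g C = g D"
  shows "(\<Sum>C\<in>partial_latin_hypercubes d k n T. g C) =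
    (\<Sum>C\<in>{C \<in> T \<rightarrow>\<^sub>E {1..n}. slicewise_bij d k n T C}. g C)"
proof (rule sum.reindex_bij_witness[where j = "\<lambda>C. restrict C T"
      and i = "\<lambda>C. \<lambda>a\<in>cells d k. if a \<in> T then C a else 0"], goal_cases)
  case (1 C)
  then show ?case
    using T by (auto simp: partial_latin_hypercubes_iff fun_eq_iff PiE_iff extensional_def)
next
  case (2 C)
  then have C: "C \<in> cells d k \<rightarrow>\<^sub>E {0..n}" "\<forall>a\<in>cells d k. C a \<noteq> 0 \<longleftrightarrow> a \<in> T"
    "slicewise_bij d k n T C" by (auto simp: partial_latin_hypercubes_iff)
  have "slicewise_bij d k n T (restrict C T) \<longleftrightarrow> slicewise_bij d k n T C"
    by (rule slicewise_bij_cong) simp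
  moreover have "C a \<in> {1..n}" if "a \<in> T" for a
    using C(1,2) T that by (force simp: PiE_iff)
  ultimately show ?case using C(3) by auto
next
  case (3 C)
  then show ?case
    using T by (auto simp: fun_eq_iff PiE_iff extensional_def)
next
  case (4 C)
  let ?C = "\<lambda>a\<in>cells d k. if a \<in> T then C a else 0"
  have "slicewise_bij d k n T ?C \<longleftrightarrow> slicewise_bij d k n T C"
    using T by (intro slicewise_bij_cong) auto
  moreover have "C a \<in> {1..n}" if "a \<in> T" for a
    using 4 that by auto
  ultimately show ?case using 4 T by (force simp: partial_latin_hypercubes_iff)
next
  case (5 C)
  then show ?case by (intro g) auto
qed

lemma hypercube_sign_eq:
  assumes "C \<in> partial_latin_hypercubes d k n T"
  shows "hypercube_sign d k C = (\<Prod>l<d. \<Prod>i\<in>{1..k}. inv_sign (T \<inter> slice d k l i) C)"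
  unfolding hypercube_sign_def
proof (intro prod.cong refl)
  fix l i assume "l \<in> {..<d}" "i \<in> {1..k}"
  then have "slice_word d k C l i \<in> permutations_of_set {1..n}"
    using assms by (auto simp: partial_latin_hypercubes_def)
  then have "word_sign (slice_word d k C l i) = msgn (slice_word d k C l i)"
    by (rule word_sign_eq_msgn)
  moreover have "slice_word d k C l i = map C (sorted_list_of_set (T \<inter> slice d k l i))"
    using assms by (intro slice_word_eq) (auto simp: partial_latin_hypercubes_iff)
  ultimately show "word_sign (slice_word d k C l i) = inv_sign (T \<inter> slice d k l i) C"
    by (simp add: msgn_map_sorted)
qed

lemma set_sign_eq: "finite T \<Longrightarrow> set_sign d T = (\<Prod>l<d. inv_sign T (\<lambda>a. a ! l))"
  by (simp add: set_sign_def msgn_map_sorted)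

lemma AT_type_eq:
  assumes "T \<subseteq> cells d k" "card T = n * k" "0 < k"
  shows "AT_type d k T = (\<Sum>C\<in>{C \<in> T \<rightarrow>\<^sub>E {1..n}. slicewise_bij d k n T C}.
    \<Prod>l<d. \<Prod>i\<in>{1..k}. inv_sign (T \<inter> slice d k l i) C)"
proof -
  have "AT_type d k T = (\<Sum>C\<in>partial_latin_hypercubes d k n T.
      \<Prod>l<d. \<Prod>i\<in>{1..k}. inv_sign (T \<inter> slice d k l i) C)"
    using assms by (simp add: AT_type_def hypercube_sign_eq)
  also have "\<dots> = (\<Sum>C\<in>{C \<in> T \<rightarrow>\<^sub>E {1..n}. slicewise_bij d k n T C}.
      \<Prod>l<d. \<Prod>i\<in>{1..k}. inv_sign (T \<inter> slice d k l i) C)"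
    using assms(1) by (intro sum_partial_latin_hypercubes prod.cong refl inv_sign_cong) auto
  finally show ?thesis .
qed

text \<open>A cell of \<open>T\<close> is determined by its slice in direction \<open>l\<close> and
  its value there. This provides the grid required by \<open>inv_sign_grid\<close>.\<close>

lemma slicewise_bij_coordinate:
  assumes T: "T \<subseteq> cells d k" and C: "C \<in> T \<rightarrow> {1..n}" "slicewise_bij d k n T C" and l: "l < d"
  shows "bij_betw (\<lambda>a. (a ! l, C a)) T ({1..k} \<times> {1..n})"
proof -
  have mem: "a \<in> T \<inter> slice d k l (a ! l)" "a ! l \<in> {1..k}" if "a \<in> T" for a
    using T that cells_nth[of a d k l] l by (auto simp: slice_def)
  have bij: "bij_betw C (T \<inter> slice d k l i) {1..n}" if "i \<in> {1..k}" for i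
    using C l that by (simp add: slicewise_bij_def)
  show ?thesis
  proof (rule bij_betw_imageI)
    show "inj_on (\<lambda>a. (a ! l, C a)) T"
    proof (rule inj_onI)
      fix a b assume ab: "a \<in> T" "b \<in> T" "(a ! l, C a) = (b ! l, C b)"
      then show "a = b"
        using mem[OF ab(1)] mem[OF ab(2)] bij[of "a ! l"] by (auto simp: bij_betw_def inj_on_def)
    qed
    show "(\<lambda>a. (a ! l, C a)) ` T = {1..k} \<times> {1..n}"
    proof (intro equalityI subsetI)
      fix z assume "z \<in> (\<lambda>a. (a ! l, C a)) ` T"
      then show "z \<in> {1..k} \<times> {1..n}" using mem(2) C(1) by auto
    next
      fix z assume "z \<in> {1..k} \<times> {1..n}"
      then obtain i j where z: "z = (i, j)" "i \<in> {1..k}" "j \<in> {1..n}" by auto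
      then have "j \<in> C ` (T \<inter> slice d k l i)" using bij[of i] by (simp add: bij_betw_def)
      then show "z \<in> (\<lambda>a. (a ! l, C a)) ` T" by (auto simp: z slice_def)
    qed
  qed
qed

section \<open>Comparison of the signs\<close>

lemma odd_power_sign: "s * s = 1 \<Longrightarrow> odd d \<Longrightarrow> s ^ d = (s::int)"
  by (auto elim!: oddE simp: power_mult power2_eq_square)

lemma grid_sign_squared [simp]: "grid_sign I J * grid_sign I J = 1"
  by (simp add: grid_sign_def power_add[symmetric] mult_2[symmetric])

text \<open>\<open>inv_sign_grid\<close> is applied to the coordinate in each direction and to
  \<open>C\<close>, and the results are multiplied. The sign of \<open>C\<close> and the grid sign
  then occur \<open>d\<close> times, which for odd \<open>d\<close> amounts to once.\<close>

lemma sign_of_slicewise_bij: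
  assumes T: "T \<subseteq> cells d k" and C: "C \<in> T \<rightarrow> {1..n}" "slicewise_bij d k n T C"
    and d: "odd d"
  shows "inv_sign T C * (\<Prod>j\<in>{1..n}. set_sign d {a \<in> T. C a = j}) =
    grid_sign {1..k} {1..n} * (set_sign d T * (\<Prod>l<d. \<Prod>i\<in>{1..k}. inv_sign (T \<inter> slice d k l i) C))"
proof -
  let ?g = "grid_sign {1..k} {1..n}"
  have fin: "finite T" using T finite_cells finite_subset by blast
  have "set_sign d T * (\<Prod>l<d. \<Prod>i\<in>{1..k}. inv_sign (T \<inter> slice d k l i) C) =
      (\<Prod>l<d. inv_sign T (\<lambda>a. a ! l) * (\<Prod>i\<in>{1..k}. inv_sign {a \<in> T. a ! l = i} C))"
  proof -
    have "T \<inter> slice d k l i = {a \<in> T. a ! l = i}" for l i using T by (auto simp: slice_def)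
    then show ?thesis by (simp add: set_sign_eq fin prod.distrib)
  qed
  also have "\<dots> = (\<Prod>l<d. ?g * (inv_sign T C * (\<Prod>j\<in>{1..n}. inv_sign {a \<in> T. C a = j} (\<lambda>a. a ! l))))"
    using fin slicewise_bij_coordinate[OF T C] by (intro prod.cong refl inv_sign_grid) auto
  also have "\<dots> = ?g ^ d * (inv_sign T C ^ d *
      (\<Prod>l<d. \<Prod>j\<in>{1..n}. inv_sign {a \<in> T. C a = j} (\<lambda>a. a ! l)))"
    by (simp only: prod.distrib prod_constant card_lessThan)
  also have "(\<Prod>l<d. \<Prod>j\<in>{1..n}. inv_sign {a \<in> T. C a = j} (\<lambda>a. a ! l)) =
      (\<Prod>j\<in>{1..n}. \<Prod>l<d. inv_sign {a \<in> T. C a = j} (\<lambda>a. a ! l))"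
    by (rule prod.swap)
  also have "\<dots> = (\<Prod>j\<in>{1..n}. set_sign d {a \<in> T. C a = j})"
    using fin by (simp add: set_sign_eq)
  also have "?g ^ d * (inv_sign T C ^ d * (\<Prod>j\<in>{1..n}. set_sign d {a \<in> T. C a = j})) =
      ?g * (inv_sign T C * (\<Prod>j\<in>{1..n}. set_sign d {a \<in> T. C a = j}))"
    using d by (simp add: odd_power_sign)
  finally show ?thesis by (simp add: mult.assoc[symmetric])
qed

text \<open>In \<open>coeff_power\<close> only those \<open>C\<close> survive all of whose fibres
  are diagonals, and these are the slicewise bijections. If one exists, all slices of
  \<open>T\<close> have \<open>n\<close> elements, so any other \<open>T\<close> has coefficient
  0.\<close>

lemma coeff_omega_power:
  assumes "odd d" "0 < k"
  shows "coeff (omega d k ^ n) T = (if magic d k T \<and> card T = n * k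
    then of_int (grid_sign {1..k} {1..n} * (set_sign d T * AT_type d k T)) else 0)"
proof (cases "finite T")
  case False
  then show ?thesis
    using finite_subset[OF _ finite_cells] by (auto simp: coeff_infinite magic_def)
next
  case fin: True
  have d: "0 < d" using assms by (auto intro: Nat.gr0I)
  let ?B = "{C \<in> T \<rightarrow>\<^sub>E {1..n}. T \<subseteq> cells d k \<and> slicewise_bij d k n T C}"
  let ?s = "\<lambda>C. inv_sign T C * (\<Prod>j\<in>{1..n}. set_sign d {a \<in> T. C a = j})"
  have "coeff (omega d k ^ n) T = (\<Sum>C\<in>T \<rightarrow>\<^sub>E {1..n}. if C \<in> ?B then of_int (?s C) else 0)"
    unfolding coeff_power[OF fin]
  proof (intro sum.cong refl)
    fix C assume C: "C \<in> T \<rightarrow>\<^sub>E {1..n}"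
    then have iff: "C \<in> ?B \<longleftrightarrow> (\<forall>j\<in>{1..n}. diagonal d k {a \<in> T. C a = j})"
      using fibers_diagonal_iff[OF d assms(2), of C T n] by auto
    show "of_int (inv_sign T C) * (\<Prod>j\<in>{1..n}. coeff (omega d k) {a \<in> T. C a = j}) =
        (if C \<in> ?B then of_int (?s C) else 0)"
    proof (cases "C \<in> ?B")
      case True
      with iff have "\<forall>j\<in>{1..n}. diagonal d k {a \<in> T. C a = j}" by blast
      with True show ?thesis by (simp add: coeff_omega[OF d assms(2)])
    next
      case False
      with iff have "\<exists>j\<in>{1..n}. coeff (omega d k) {a \<in> T. C a = j} = 0"
        by (auto simp: coeff_omega[OF d assms(2)])
      then have "(\<Prod>j\<in>{1..n}. coeff (omega d k) {a \<in> T. C a = j}) = 0"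
        by (intro prod_zero) auto
      then show ?thesis by (simp only: False if_False mult_zero_right)
    qed
  qed
  also have "\<dots> = of_int (\<Sum>C\<in>?B. ?s C)"
    using fin by (simp add: sum.inter_filter[symmetric] finite_PiE)
  also have "(\<Sum>C\<in>?B. ?s C) = (if magic d k T \<and> card T = n * k
    then grid_sign {1..k} {1..n} * (set_sign d T * AT_type d k T) else 0)"
  proof (cases "magic d k T \<and> card T = n * k")
    case True
    then have T: "T \<subseteq> cells d k" by (simp add: magic_def)
    have "(\<Sum>C\<in>?B. ?s C) = (\<Sum>C\<in>{C \<in> T \<rightarrow>\<^sub>E {1..n}. slicewise_bij d k n T C}.
        grid_sign {1..k} {1..n} *
          (set_sign d T * (\<Prod>l<d. \<Prod>i\<in>{1..k}. inv_sign (T \<inter> slice d k l i) C)))"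
      using T assms(1) by (intro sum.cong sign_of_slicewise_bij) auto
    then show ?thesis using True assms(2) T by (simp add: AT_type_eq sum_distrib_left)
  next
    case False
    have "?B = {}"
    proof (rule ccontr)
      assume "?B \<noteq> {}"
      then obtain C where T: "T \<subseteq> cells d k" and C: "slicewise_bij d k n T C" by blast
      have "card (T \<inter> slice d k l i) = n" if "l < d" "i \<in> {1..k}" for l i
        using C that bij_betw_same_card[of C "T \<inter> slice d k l i" "{1..n}"]
        by (simp add: slicewise_bij_def)
      with T False show False by (simp add: magic_card_iff[OF d assms(2)])
    qed
    then show ?thesis using False by (simp only: sum.empty if_False)
  qed
  finally show ?thesis by simp
qed

lemma finite_magic: "finite {T. magic d k T \<and> card T = m}"
  by (rule finite_subset[of _ "Pow (cells d k)"]) (auto simp: magic_def finite_cells)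

lemma omega_power_eq:
  assumes "odd d" "0 < k"
  shows "omega d k ^ n = scale (of_int (grid_sign {1..k} {1..n}))
    (\<Sum>T | magic d k T \<and> card T = n * k. scale (of_int (set_sign d T * AT_type d k T)) (psi T))"
proof (rule exterior_eqI)
  fix S :: "nat list set"
  let ?M = "{T. magic d k T \<and> card T = n * k}"
  let ?c = "\<lambda>T. of_int (set_sign d T * AT_type d k T) :: complex"
  have "(\<Sum>T\<in>?M. ?c T * coeff (psi T) S) = (\<Sum>T\<in>?M. if T = S then ?c S else 0)"
  proof (intro sum.cong refl)
    fix T assume "T \<in> ?M"
    then have "finite T" by (auto simp: magic_def intro: finite_subset[OF _ finite_cells])
    then show "?c T * coeff (psi T) S = (if T = S then ?c S else 0)" by (simp add: coeff_psi)
  qed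
  also have "\<dots> = (if S \<in> ?M then ?c S else 0)" by (simp add: finite_magic)
  finally show "coeff (omega d k ^ n) S =
      coeff (scale (of_int (grid_sign {1..k} {1..n})) (\<Sum>T\<in>?M. scale (?c T) (psi T))) S"
    by (simp add: coeff_omega_power[OF assms])
qed

section \<open>The full cube as the only magic set of its size\<close>

lemma card_cells: "card (cells d k) = k ^ d"
  using card_lists_length_eq[of "{1..k}" d] by (simp add: cells_def conj_commute)

lemma card_slice:
  assumes "l < d" "i \<in> {1..k}"
  shows "card (slice d k l i) = k ^ (d - 1)"
proof -
  \<comment> \<open>Overwriting the coordinate in direction \<open>l\<close> identifies any two
    slices in this direction.\<close>
  have "card (slice d k l j) = card (slice d k l i)" if "j \<in> {1..k}" for j
  proof (rule bij_betw_same_card, rule bij_betw_byWitness[where f' = "\<lambda>a. a[l := j]"])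
    show "(\<lambda>a. a[l := i]) ` slice d k l j \<subseteq> slice d k l i"
      "(\<lambda>a. a[l := j]) ` slice d k l i \<subseteq> slice d k l j"
      using assms that by (auto simp: slice_def cells_def dest!: subsetD[OF set_update_subset_insert])
  qed (auto simp: slice_def)
  moreover have "cells d k \<inter> slice d k l j = slice d k l j" for j using slice_subset_cells by blast
  ultimately have "k ^ d = k * card (slice d k l i)"
    using card_eq_sum_slices[of "cells d k" d k l] assms(1) by (simp add: card_cells)
  moreover have "k ^ d = k * k ^ (d - 1)" using assms by (cases d) auto
  ultimately show ?thesis using assms by simp
qed

lemma magic_full_card:
  assumes "0 < d" "0 < k"
  shows "{T. magic d k T \<and> card T = k ^ (d - 1) * k} = {cells d k}"
proof -
  have "k ^ (d - 1) * k = card (cells d k)"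
    using assms by (cases d) (simp_all add: card_cells)
  then have "T = cells d k" if "magic d k T" "card T = k ^ (d - 1) * k" for T
    using that card_subset_eq[OF finite_cells, of T] by (simp add: magic_def)
  moreover have "cells d k \<inter> slice d k l j = slice d k l j" for l j using slice_subset_cells by blast
  then have "magic d k (cells d k) \<and> card (cells d k) = k ^ (d - 1) * k"
    using magic_card_iff[OF assms] card_slice by simp
  ultimately show ?thesis by blast
qed

lemma omega_full_power:
  assumes "odd d" "0 < k"
  shows "omega d k ^ (k ^ (d - 1)) =
    scale (of_int (grid_sign {1..k} {1..k ^ (d - 1)} * set_sign d (cells d k)))
      (scale (of_int (AT d k)) (psi (cells d k)))"
proof -
  have "0 < d" using assms by (auto intro: Nat.gr0I)
  then show ?thesis
    unfolding omega_power_eq[OF assms] magic_full_card[OF \<open>0 < d\<close> assms(2)] by (simp add: AT_def mult_ac)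
qed

section \<open>Highest weight vectors\<close>

lemma tensor_zero_factor:
  assumes "m < length vs" "vs ! m = (\<lambda>_. 0)"
  shows "tensor k vs = 0"
proof -
  have "(\<Prod>l<length vs. (vs ! l) (a ! l)) = 0" for a
    using assms by (intro prod_zero bexI[of _ m]) auto
  then show ?thesis by (simp only: tensor_def exterior.scale_zero_left sum.neutral_const)
qed

lemma matvec_matrix_unit:
  assumes "i + 1 \<in> {1..k}"
  shows "matvec k (matrix_unit i (i + 1)) (std c) = (if c = i + 1 then std i else (\<lambda>_. 0))"
proof
  fix r
  have "matvec k (matrix_unit i (i + 1)) (std c) r =
      (\<Sum>j\<in>{1..k}. if j = i + 1 then (if r = i \<and> c = i + 1 then 1 else 0) else 0)"
    unfolding matvec_def matrix_unit_def std_def by (intro sum.cong) auto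
  also have "\<dots> = (if c = i + 1 then std i else (\<lambda>_. 0)) r"
    using assms by (simp add: std_def)
  finally show "matvec k (matrix_unit i (i + 1)) (std c) r =
    (if c = i + 1 then std i else (\<lambda>_. 0)) r" .
qed

text \<open>A zero tensor factor kills a term. This removes the directions other than
  \<open>l\<close>, where the matrix is zero, and also direction \<open>l\<close> unless the entry
  there is \<open>i + 1\<close>.\<close>

lemma gl_tensor_raising:
  assumes a: "a \<in> cells d k" and l: "l < d" and i: "1 \<le> i" "i < k"
  shows "gl_tensor d k (raising l i) a = (if a ! l = i + 1 then gen (a[l := i]) else 0)"
proof -
  have len: "length a = d" using a by (simp add: cells_def)
  have other: "tensor k ((map std a)[m := matvec k (raising l i m) (std (a ! m))]) = 0"
    if "m < d" "m \<noteq> l" for m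
    using that len by (intro tensor_zero_factor[of m]) (auto simp: raising_def matvec_def)
  have "gl_tensor d k (raising l i) a =
      (\<Sum>m<d. if m = l then tensor k ((map std a)[l := matvec k (matrix_unit i (i + 1)) (std (a ! l))])
        else 0)"
    unfolding gl_tensor_def using other by (intro sum.cong refl) (auto simp: raising_def)
  also have "\<dots> = tensor k ((map std a)[l := matvec k (matrix_unit i (i + 1)) (std (a ! l))])"
    using l by simp
  also have "\<dots> = (if a ! l = i + 1 then gen (a[l := i]) else 0)"
  proof (cases "a ! l = i + 1")
    case True
    have "a[l := i] \<in> cells d k"
      using a i set_update_subset_insert[of a l i] by (auto simp: cells_def)
    then have "tensor k ((map std a)[l := std i]) = gen (a[l := i])"
      using tensor_std[of "a[l := i]" d k] by (simp add: map_update)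
    then show ?thesis using True i matvec_matrix_unit[of i k "i + 1"] by simp
  next
    case False
    then show ?thesis
      using i l len matvec_matrix_unit[of i k "a ! l"] by (auto intro: tensor_zero_factor[of l])
  qed
  finally show ?thesis .
qed

text \<open>Cells with another entry stay fixed here although the raising operator sends them to 0:
  they are the untouched factors in the one surviving term of the product rule.\<close>

definition lower_coord :: "nat \<Rightarrow> nat \<Rightarrow> nat list \<Rightarrow> nat list" where
  "lower_coord l i a = (if a ! l = i + 1 then a[l := i] else a)"

lemma prod_list_zero_mem: "(0::'a::ring_1) \<in> set xs \<Longrightarrow> prod_list xs = 0"
  by (induction xs) auto

lemma diagonal_coord_eq:
  assumes "0 < d" "0 < k" "diagonal d k T" "a \<in> T" "b \<in> T" "l < d" "a ! l = b ! l"
  shows "a = b"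
proof -
  have T: "T \<subseteq> cells d k" "\<And>i. i \<in> {1..k} \<Longrightarrow> card (T \<inter> slice d k l i) = 1"
    using assms(3,6) unfolding diagonal_iff[OF assms(1,2)] by blast+
  then obtain c where "T \<inter> slice d k l (a ! l) = {c}"
    using cells_nth[of a d k l] assms by (meson card_1_singletonE subsetD)
  moreover have "a \<in> T \<inter> slice d k l (a ! l) \<and> b \<in> T \<inter> slice d k l (a ! l)"
    using T assms by (auto simp: slice_def)
  ultimately show ?thesis by (simp only: singleton_iff)
qed

lemma diagonal_coord_obtain:
  assumes "0 < d" "0 < k" "diagonal d k T" "l < d" "i \<in> {1..k}"
  obtains a where "a \<in> T" "a ! l = i" "a \<in> cells d k"
proof -
  have "card (T \<inter> slice d k l i) = 1"
    using assms(3-5) unfolding diagonal_iff[OF assms(1,2)] by blast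
  then obtain a where "T \<inter> slice d k l i = {a}" by (rule card_1_singletonE)
  then have "a \<in> T" "a \<in> slice d k l i" by auto
  then show ?thesis using that[of a] by (simp add: slice_def)
qed

text \<open>The product rule gives one term per cell. A diagonal has just one cell with entry
  \<open>i + 1\<close> in direction \<open>l\<close>, so all other terms contain a zero
  factor.\<close>

lemma raise_diagonal:
  assumes d: "0 < d" and T: "diagonal d k T" and xs: "set xs = T" "distinct xs"
    and l: "l < d" and i: "1 \<le> i" "i < k"
  shows "gl_act d k (raising l i) (prod_list (map gen xs)) =
    prod_list (map gen (map (lower_coord l i) xs))"
proof -
  let ?f = "gl_tensor d k (raising l i)"
  have k: "0 < k" using i by simp
  have cells: "a \<in> cells d k" if "a \<in> T" for a using T that by (auto simp: diagonal_def magic_def)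
  obtain a where a: "a \<in> T" "a ! l = i + 1"
    using diagonal_coord_obtain[OF d k T l, of "i + 1"] i by auto
  obtain j where j: "j < length xs" "xs ! j = a" using a(1) xs(1) by (auto simp: in_set_conv_nth)
  have only: "xs ! m ! l \<noteq> i + 1" if "m < length xs" "m \<noteq> j" for m
  proof
    assume "xs ! m ! l = i + 1"
    then have "xs ! m = xs ! j"
      using diagonal_coord_eq[OF d k T _ _ l, of "xs ! m" "xs ! j"] a j that xs(1) nth_mem by auto
    then show False using nth_eq_iff_index_eq[OF xs(2) that(1) j(1)] that(2) by simp
  qed
  have zero: "prod_list ((map gen xs)[m := ?f (xs ! m)]) = 0" if "m < length xs" "m \<noteq> j" for m
  proof -
    have "?f (xs ! m) = 0"
      using gl_tensor_raising[OF cells l i, of "xs ! m"] only[OF that] nth_mem[OF that(1)] xs(1) by simp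
    then have "0 \<in> set ((map gen xs)[m := ?f (xs ! m)])"
      using that(1) by (metis length_map set_update_memI)
    then show ?thesis by (rule prod_list_zero_mem)
  qed
  have "gl_act d k (raising l i) (prod_list (map gen xs)) = derivation_list ?f xs"
    unfolding gl_act_def by (rule derivation_ext_prod_list[OF gl_tensor_degree_one])
  also have "\<dots> = (\<Sum>m<length xs. if m = j then prod_list ((map gen xs)[j := ?f (xs ! j)]) else 0)"
    unfolding derivation_list_def using zero by (intro sum.cong refl) auto
  also have "\<dots> = prod_list ((map gen xs)[j := ?f (xs ! j)])" using j by simp
  also have "(map gen xs)[j := ?f (xs ! j)] = map gen (map (lower_coord l i) xs)"
  proof (rule nth_equalityI)
    fix m assume "m < length ((map gen xs)[j := ?f (xs ! j)])"
    then show "(map gen xs)[j := ?f (xs ! j)] ! m = map gen (map (lower_coord l i) xs) ! m"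
      using gl_tensor_raising[OF cells[OF a(1)] l i] a j only[of m]
      by (cases "m = j") (simp_all add: lower_coord_def)
  qed simp
  finally show ?thesis .
qed

lemma wedge_eq: "wedge k g = prod_list (map gen (map g [1..<k + 1]))"
  by (simp add: wedge_def comp_def)

text \<open>The result is stated with \<open>wedge\<close> and not with \<open>psi\<close> because
  the lowered cells need not be in increasing order.\<close>

lemma raise_wedge:
  assumes "0 < d" "perm_tuple d k p" "l < d" "1 \<le> i" "i < k"
  shows "gl_act d k (raising l i) (wedge k (diag_cell d p)) =
    wedge k (lower_coord l i \<circ> diag_cell d p)"
proof -
  have "inj_on (diag_cell d p) {1..k}"
  proof (rule inj_onI)
    fix j m assume "diag_cell d p j = diag_cell d p m"
    then have "diag_cell d p j ! l = diag_cell d p m ! l" by simp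
    then show "j = m"
      using assms by (auto simp: perm_tuple_def dest: permutes_inj injD)
  qed
  then have "distinct (map (diag_cell d p) [1..<k + 1])"
    by (simp add: distinct_map atLeastLessThanSuc_atLeastAtMost del: upt_Suc)
  then show ?thesis
    using raise_diagonal[OF assms(1) diagonal_diag_cell[OF assms(1) _ assms(2)] set_diag_cells]
      assms by (simp only: wedge_eq map_map)
qed

lemma lower_coord_diag_cell:
  assumes "l < d"
  shows "lower_coord l i (diag_cell d q j) =
    diag_cell d (q(l := (\<lambda>x. if x = i + 1 then i else x) \<circ> q l)) j"
    (is "?a = ?b")
proof (rule nth_equalityI)
  show len: "length ?a = length ?b" by (simp add: lower_coord_def)
  fix m assume "m < length ?a"
  then have "m < d" using len by simp
  then show "?a ! m = ?b ! m"
    using assms by (cases "m = l") (simp_all add: lower_coord_def)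
qed

lemma wedge_transpose:
  assumes "1 \<le> i" "i < k"
  shows "wedge k (g \<circ> transpose i (i + 1)) = - wedge k g"
proof -
  have "[1..<k + 1] = [1..<i] @ [i..<k + 1]"
    using assms upt_add_eq_append[of 1 i "k + 1 - i"] by simp
  also have "[i..<k + 1] = i # (i + 1) # [i + 2..<k + 1]"
    using assms by (simp add: upt_conv_Cons)
  finally have split: "[1..<k + 1] = [1..<i] @ i # (i + 1) # [i + 2..<k + 1]" .
  have m: "map (\<lambda>j. gen ((g \<circ> transpose i (i + 1)) j)) [1..<i] = map (\<lambda>j. gen (g j)) [1..<i]"
    "map (\<lambda>j. gen ((g \<circ> transpose i (i + 1)) j)) [i + 2..<k + 1] = map (\<lambda>j. gen (g j)) [i + 2..<k + 1]"
    by (auto simp: transpose_def)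
  have "wedge k (g \<circ> transpose i (i + 1)) = prod_list (map (\<lambda>j. gen (g j)) [1..<i]) *
      ((gen (g (i + 1)) * gen (g i)) * prod_list (map (\<lambda>j. gen (g j)) [i + 2..<k + 1]))"
    unfolding wedge_def split map_append list.map m by (simp add: mult.assoc del: upt_Suc)
  also have "\<dots> = - wedge k g"
    unfolding gen_anticommute[of "g (i + 1)"] wedge_def split by (simp add: mult.assoc del: upt_Suc)
  finally show ?thesis .
qed

section \<open>Cancellation of the raised terms of omega\<close>

lemma exterior_eq_neg_zero:
  fixes x :: "'b exterior"
  assumes "x = - x"
  shows "x = 0"
proof (rule exterior_eqI)
  fix S
  have "coeff x S = - coeff x S" using assms by (metis coeff_simps(3))
  then show "coeff x S = coeff 0 S" by simp
qed

lemma gl_act_add: "gl_act d k X (x + y) = gl_act d k X x + gl_act d k X y"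
  and gl_act_scale: "gl_act d k X (scale c x) = scale c (gl_act d k X x)"
  and gl_act_sum: "gl_act d k X (sum g A) = (\<Sum>a\<in>A. gl_act d k X (g a))"
  by (simp_all add: gl_act_def derivation_ext_add derivation_ext_scale derivation_ext_sum)

text \<open>Reindexing along the involution \<open>F\<close> shows that the sum equals its own
  negative.\<close>

lemma sum_sign_reversing:
  fixes h :: "'a \<Rightarrow> 'b exterior"
  assumes "\<And>p. p \<in> A \<Longrightarrow> F p \<in> A" "\<And>p. p \<in> A \<Longrightarrow> F (F p) = p"
    "\<And>p. p \<in> A \<Longrightarrow> h (F p) = - h p"
  shows "sum h A = 0"
proof (rule exterior_eq_neg_zero)
  have "sum h A = (\<Sum>p\<in>A. - h p)"
    using assms by (intro sum.reindex_bij_witness[where i = F and j = F]) auto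
  then show "sum h A = - sum h A" by (simp add: sum_negf)
qed

text \<open>
  The terms of \<open>omega\<close> cancel in pairs after raising: for \<open>l > 0\<close>, by exchanging the values
  \<open>i\<close> and \<open>i + 1\<close> of \<open>p l\<close>; for \<open>l = 0\<close>, by exchanging the arguments \<open>i\<close> and \<open>i + 1\<close> of all
  permutations, which does not change their sign since \<open>d - 1\<close> is even.
\<close>

lemma raise_omega:
  assumes "odd d" "l < d" "1 \<le> i" "i < k"
  shows "gl_act d k (raising l i) (omega d k) = 0"
proof -
  have d: "0 < d" using assms by auto
  let ?\<tau> = "transpose i (i + 1)"
  let ?f = "\<lambda>x. if x = i + 1 then i else x"
  let ?c = "\<lambda>p. of_int (\<Prod>m\<in>{1..<d}. sign (p m)) :: complex"
  let ?h = "\<lambda>p. scale (?c p) (wedge k (lower_coord l i \<circ> diag_cell d (p(0 := id))))"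
  have \<tau>: "?\<tau> permutes {1..k}" using assms by (intro permutes_swap_id) auto
  have f\<tau>: "?f (?\<tau> x) = ?f x" for x by (simp add: transpose_def)
  have sgn\<tau>: "sign ?\<tau> = - 1" by (simp add: sign_swap_id)
  have perm\<tau>: "permutation ?\<tau>" by (rule permutation_swap_id)
  have perm: "p m permutes {1..k}" "permutation (p m)" if "p \<in> omega_index d k" "m \<in> {1..<d}" for p m
    using that by (auto simp: omega_index_def PiE_iff intro: permutes_imp_permutation[of "{1..k}"])
  have sum0: "sum ?h (omega_index d k) = 0"
  proof (cases "l = 0")
    case False
    let ?F = "\<lambda>p. p(l := ?\<tau> \<circ> p l)"
    have l: "l \<in> {1..<d}" using False assms by simp
    show ?thesis
    proof (rule sum_sign_reversing[where F = ?F])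
      fix p assume p: "p \<in> omega_index d k"
      show "?F p \<in> omega_index d k"
        using p l permutes_compose[OF perm(1)[OF p l] \<tau>] by (auto simp: omega_index_def PiE_iff extensional_def)
      show "?F (?F p) = p" by (auto simp: fun_eq_iff)
      have "(\<Prod>m\<in>{1..<d}. sign (?F p m)) = sign (?\<tau> \<circ> p l) * (\<Prod>m\<in>{1..<d} - {l}. sign (p m))"
        using l by (subst prod.remove[of _ l]) auto
      also have "\<dots> = - (\<Prod>m\<in>{1..<d}. sign (p m))"
        using l perm(2)[OF p l] perm\<tau> sgn\<tau> prod.remove[of "{1..<d}" l "\<lambda>m. sign (p m)"]
        by (simp add: sign_compose)
      finally have "?c (?F p) = - ?c p" by simp
      moreover have "lower_coord l i \<circ> diag_cell d ((?F p)(0 := id)) =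
          lower_coord l i \<circ> diag_cell d (p(0 := id))"
      proof
        fix j
        have "((?F p)(0 := id)) l = ?\<tau> \<circ> p l" "(p(0 := id)) l = p l"
          using False by simp_all
        \<comment> \<open>Lowering merges the values \<open>i\<close> and \<open>i + 1\<close>, so
          it cannot see their exchange.\<close>
        moreover have "?f \<circ> (?\<tau> \<circ> p l) = ?f \<circ> p l"
          by (auto simp: fun_eq_iff transpose_def)
        ultimately have "((?F p)(0 := id))(l := ?f \<circ> ((?F p)(0 := id)) l) =
            (p(0 := id))(l := ?f \<circ> (p(0 := id)) l)"
          using False by (simp only:, auto simp: fun_eq_iff)
        then show "(lower_coord l i \<circ> diag_cell d ((?F p)(0 := id))) j =
            (lower_coord l i \<circ> diag_cell d (p(0 := id))) j"
          unfolding comp_apply lower_coord_diag_cell[OF assms(2)] by (simp only:)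
      qed
      ultimately show "?h (?F p) = - ?h p" by simp
    qed
  next
    case True
    let ?F = "\<lambda>p. \<lambda>m\<in>{1..<d}. p m \<circ> ?\<tau>"
    show ?thesis
    proof (rule sum_sign_reversing[where F = ?F])
      fix p assume p: "p \<in> omega_index d k"
      show "?F p \<in> omega_index d k"
        using permutes_compose[OF \<tau> perm(1)[OF p]] by (auto simp: omega_index_def)
      show "?F (?F p) = p"
        using p by (auto simp: fun_eq_iff omega_index_def PiE_iff extensional_def)
      have "(\<Prod>m\<in>{1..<d}. sign (?F p m)) = (\<Prod>m\<in>{1..<d}. sign (p m) * - 1)"
        using perm(2)[OF p] perm\<tau> sgn\<tau> by (intro prod.cong refl) (simp add: sign_compose)
      also have "\<dots> = (\<Prod>m\<in>{1..<d}. sign (p m))"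
        unfolding prod.distrib prod_constant using assms(1) by simp
      finally have "?c (?F p) = ?c p" by simp
      \<comment> \<open>In direction 0 the new tuple still has \<open>id\<close>, whereas
        precomposing with the transposition would give the transposition itself. Lowering in
        direction 0 hides this difference.\<close>
      moreover have "lower_coord l i \<circ> diag_cell d ((?F p)(0 := id)) =
          (lower_coord l i \<circ> diag_cell d (p(0 := id))) \<circ> ?\<tau>"
      proof
        fix j
        show "(lower_coord l i \<circ> diag_cell d ((?F p)(0 := id))) j =
            ((lower_coord l i \<circ> diag_cell d (p(0 := id))) \<circ> ?\<tau>) j"
          unfolding comp_apply lower_coord_diag_cell[OF assms(2)]
          using True f\<tau>[of j] by (intro nth_equalityI) auto
      qed
      ultimately show "?h (?F p) = - ?h p" using assms by (simp only: wedge_transpose) simp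
    qed
  qed
  have "gl_act d k (raising l i) (omega d k) = sum ?h (omega_index d k)"
    using assms d by (simp add: omega_eq_wedges gl_act_sum gl_act_scale raise_wedge perm_tuple_omega_index)
  then show ?thesis using sum0 by simp
qed

section \<open>Coefficients of highest weight vectors and uniqueness up to scalars\<close>

lemma magic_space_1_iff: "x \<in> magic_space d k 1 \<longleftrightarrow> (\<forall>T. coeff x T \<noteq> 0 \<longrightarrow> diagonal d k T)"
proof
  assume "x \<in> magic_space d k 1"
  then show "\<forall>T. coeff x T \<noteq> 0 \<longrightarrow> diagonal d k T"
    unfolding magic_space_def
  proof (induction rule: exterior.span_induct_alt)
    case (step c y z)
    then obtain P where P: "y = psi P" "diagonal d k P" by (auto simp: diagonal_def)
    then show ?case using step.IH diagonal_finite[OF P(2)] by (auto simp: coeff_psi)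
  qed simp
next
  assume diag: "\<forall>T. coeff x T \<noteq> 0 \<longrightarrow> diagonal d k T"
  have "(\<Sum>P | coeff x P \<noteq> 0. scale (coeff x P) (psi P)) \<in> magic_space d k 1"
    unfolding magic_space_def using diag
    by (intro exterior.span_sum exterior.span_scale exterior.span_base) (auto simp: diagonal_def)
  then show "x \<in> magic_space d k 1" by (simp add: exterior_expand[of x, symmetric])
qed

text \<open>The uniqueness argument only asks whether a coefficient vanishes, so the sign from
  sorting the factors is not tracked.\<close>

lemma coeff_prod_list_gen_nonzero_iff:
  "finite S \<Longrightarrow> coeff (prod_list (map gen xs)) S \<noteq> 0 \<longleftrightarrow> distinct xs \<and> S = set xs"
proof (induction xs arbitrary: S)
  case Nil
  then show ?case by (simp add: one_exterior.rep_eq)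
next
  case (Cons x xs)
  have "x \<in> S \<and> S - {x} = set xs \<longleftrightarrow> x \<notin> set xs \<and> S = insert x (set xs)" by auto
  then show ?case using Cons by (auto simp: coeff_gen_mult shuffle_sign_def)
qed

definition swap_coord :: "nat \<Rightarrow> nat \<Rightarrow> nat list \<Rightarrow> nat list" where
  "swap_coord l i a = a[l := transpose i (i + 1) (a ! l)]"

lemma lower_swap_coord:
  assumes "l < length a"
  shows "lower_coord l i (swap_coord l i a) = lower_coord l i a"
proof -
  consider "a ! l = i" | "a ! l = i + 1" | "a ! l \<noteq> i" "a ! l \<noteq> i + 1" by blast
  then show ?thesis
  proof cases
    case 1
    then have "a[l := i] = a" by (metis list_update_id)
    then show ?thesis using 1 assms by (simp add: lower_coord_def swap_coord_def)
  qed (use assms in \<open>simp_all add: lower_coord_def swap_coord_def\<close>)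
qed

lemma swap_coord_diag_cell:
  assumes "l < d"
  shows "swap_coord l i (diag_cell d p j) = diag_cell d (p(l := transpose i (i + 1) \<circ> p l)) j"
    (is "?a = ?b")
proof (rule nth_equalityI)
  show len: "length ?a = length ?b" by (simp add: swap_coord_def)
  fix m assume "m < length ?a"
  then have "m < d" using len by simp
  then show "?a ! m = ?b ! m"
    using assms by (cases "m = l") (simp_all add: swap_coord_def)
qed

text \<open>With \<open>2 \<le> d\<close> there is a direction other than \<open>l\<close>. Lowering
  does not touch it, and its coordinate alone separates the cells of a diagonal.\<close>

lemma diagonal_lower_coord_inj:
  assumes d: "2 \<le> d" and k: "0 < k" and T: "diagonal d k T" and l: "l < d"
  shows "inj_on (lower_coord l i) T"
proof (rule inj_onI)
  fix a b assume ab: "a \<in> T" "b \<in> T" "lower_coord l i a = lower_coord l i b"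
  obtain m where m: "m < d" "m \<noteq> l" using d l by (cases "l = 0") (auto intro: that[of 0] that[of 1])
  have "lower_coord l i a ! m = a ! m" for a using m by (auto simp: lower_coord_def)
  then have "a ! m = b ! m" using ab by metis
  then show "a = b" using diagonal_coord_eq[OF _ k T ab(1,2) m(1)] d by simp
qed

text \<open>In the lowered set, the entry \<open>i\<close> in direction \<open>l\<close> occurs only
  at the images of the two cells with entries \<open>i + 1\<close> and \<open>i\<close>. The
  original diagonal is recovered by choosing which image is raised back to
  \<open>i + 1\<close>.\<close>

lemma lower_coord_fiber:
  assumes d: "0 < d" and P: "diagonal d k P" and T: "diagonal d k T"
    and l: "l < d" and i: "1 \<le> i" "i < k"
    and eq: "lower_coord l i ` T = lower_coord l i ` P"
  shows "T = P \<or> T = swap_coord l i ` P"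
proof -
  have k: "0 < k" using i by simp
  have decomp: "\<exists>a b. Q = {x \<in> lower_coord l i ` Q. x ! l \<noteq> i} \<union> {a, b} \<and>
      {x \<in> lower_coord l i ` Q. x ! l = i} = {a[l := i], b} \<and>
      a ! l = i + 1 \<and> b ! l = i \<and> length a = d \<and> length b = d"
    if Q: "diagonal d k Q" for Q
  proof -
    obtain a where a: "a \<in> Q" "a ! l = i + 1" "a \<in> cells d k"
      using diagonal_coord_obtain[OF d k Q l, of "i + 1"] i by auto
    obtain b where b: "b \<in> Q" "b ! l = i" "b \<in> cells d k"
      using diagonal_coord_obtain[OF d k Q l, of i] i by auto
    have len: "length a = d" "length b = d" using a b by (simp_all add: cells_def)
    have eq_a: "x = a" if "x \<in> Q" "x ! l = i + 1" for x
      using diagonal_coord_eq[OF d k Q that(1) a(1) l] that a by simp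
    have eq_b: "x = b" if "x \<in> Q" "x ! l = i" for x
      using diagonal_coord_eq[OF d k Q that(1) b(1) l] that b by simp
    have fixed: "lower_coord l i x = x" "x ! l \<noteq> i" if "x \<in> Q - {a, b}" for x
      using that eq_a eq_b by (auto simp: lower_coord_def)
    have "lower_coord l i a = a[l := i]" "lower_coord l i b = b"
      using a b by (simp_all add: lower_coord_def)
    then have "lower_coord l i ` {a, b} = {a[l := i], b}" by simp
    moreover have "lower_coord l i ` (Q - {a, b}) = Q - {a, b}"
      using fixed(1) by (simp cong: image_cong_simp)
    moreover have "lower_coord l i ` Q = lower_coord l i ` (Q - {a, b}) \<union> lower_coord l i ` {a, b}"
      using a(1) b(1) by auto
    ultimately have "lower_coord l i ` Q = (Q - {a, b}) \<union> {a[l := i], b}" by simp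
    moreover have "Q = (Q - {a, b}) \<union> {a, b}" using a b by auto
    moreover have "a[l := i] ! l = i" using len l by simp
    ultimately have "Q = {x \<in> lower_coord l i ` Q. x ! l \<noteq> i} \<union> {a, b}"
      "{x \<in> lower_coord l i ` Q. x ! l = i} = {a[l := i], b}"
      using b(2) fixed(2) by auto
    then show ?thesis using a b len by blast
  qed
  define Z where "Z = {x \<in> lower_coord l i ` P. x ! l \<noteq> i}"
  obtain a b where P': "P = Z \<union> {a, b}" "{x \<in> lower_coord l i ` P. x ! l = i} = {a[l := i], b}"
    and ab: "a ! l = i + 1" "b ! l = i" "length a = d" "length b = d"
    using decomp[OF P] unfolding Z_def by blast
  obtain a' b' where T': "T = Z \<union> {a', b'}" "{x \<in> lower_coord l i ` P. x ! l = i} = {a'[l := i], b'}"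
    and ab': "a' ! l = i + 1" "b' ! l = i" "length a' = d" "length b' = d"
    using decomp[OF T] unfolding Z_def eq by blast
  have up: "a = (a[l := i])[l := i + 1]" "a' = (a'[l := i])[l := i + 1]"
    using ab(1) ab'(1) by (metis list_update_id list_update_overwrite)+
  have Z: "swap_coord l i x = x" if "x \<in> Z" for x
  proof -
    from that obtain y where y: "y \<in> P" "x = lower_coord l i y" "x ! l \<noteq> i" by (auto simp: Z_def)
    moreover have "length y = d" using y(1) P by (auto simp: diagonal_def magic_def cells_def)
    ultimately have "x ! l \<noteq> i + 1" using l by (auto simp: lower_coord_def split: if_splits)
    then show ?thesis using y(3) by (simp add: swap_coord_def)
  qed
  \<comment> \<open>The unordered pairs agree, so their members match either directly, giving
    \<open>P\<close>, or crosswise, giving the swapped diagonal.\<close>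
  have "{a'[l := i], b'} = {a[l := i], b}"
    by (rule trans[OF T'(2)[symmetric] P'(2)])
  then consider "a'[l := i] = a[l := i]" "b' = b" | "a'[l := i] = b" "b' = a[l := i]"
    by (auto simp: doubleton_eq_iff)
  then show ?thesis
  proof cases
    case 1
    then have "a' = a" using up by simp
    then have "T = P" by (simp only: P'(1) T'(1) 1(2))
    then show ?thesis ..
  next
    case 2
    have "swap_coord l i ` Z = Z" using Z by (simp cong: image_cong_simp)
    then have "swap_coord l i ` P = Z \<union> {swap_coord l i a, swap_coord l i b}"
      by (simp only: P'(1) image_Un image_insert image_empty)
    also have "swap_coord l i a = b'" using 2 ab by (simp add: swap_coord_def)
    also have "swap_coord l i b = a'" using 2 ab up by (simp add: swap_coord_def)
    finally show ?thesis using T'(1) by (metis insert_commute)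
  qed
qed

text \<open>
  The coefficient of the raised vector at \<open>lower_coord l i ` P\<close> only involves the coefficients
  at \<open>P\<close> and at \<open>swap_coord l i ` P\<close>.
\<close>

lemma raise_zero_swap:
  assumes d: "2 \<le> d" and supp: "\<And>T. coeff u T \<noteq> 0 \<Longrightarrow> diagonal d k T"
    and P: "diagonal d k P" "diagonal d k (swap_coord l i ` P)" and l: "l < d" and i: "1 \<le> i" "i < k"
    and raise: "gl_act d k (raising l i) u = 0" and zero: "coeff u P = 0"
  shows "coeff u (swap_coord l i ` P) = 0"
proof (rule ccontr)
  let ?Q = "swap_coord l i ` P"
  let ?R = "lower_coord l i ` ?Q"
  assume Q: "coeff u ?Q \<noteq> 0"
  have d0: "0 < d" and k: "0 < k" using d i by simp_all
  have fin: "finite ?R" using diagonal_finite[OF P(1)] by simp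
  have R: "?R = lower_coord l i ` P"
  proof -
    have "\<forall>a\<in>P. length a = d" using P(1) by (auto simp: diagonal_def magic_def cells_def)
    then show ?thesis using l by (simp add: image_image lower_swap_coord)
  qed
  have psi: "coeff (gl_act d k (raising l i) (psi T)) ?R \<noteq> 0 \<longleftrightarrow> lower_coord l i ` T = ?R"
    if T: "diagonal d k T" for T
  proof -
    have "set (sorted_list_of_set T) = T" using diagonal_finite[OF T] by simp
    then have "gl_act d k (raising l i) (psi T) =
        prod_list (map gen (map (lower_coord l i) (sorted_list_of_set T)))"
      unfolding psi_def using raise_diagonal[OF d0 T _ _ l i] by simp
    then have "coeff (gl_act d k (raising l i) (psi T)) ?R \<noteq> 0 \<longleftrightarrow>
        distinct (map (lower_coord l i) (sorted_list_of_set T)) \<and>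
        ?R = set (map (lower_coord l i) (sorted_list_of_set T))"
      by (simp only: coeff_prod_list_gen_nonzero_iff[OF fin])
    moreover have "distinct (map (lower_coord l i) (sorted_list_of_set T))"
      using diagonal_finite[OF T] diagonal_lower_coord_inj[OF d k T l] by (simp add: distinct_map)
    moreover have "set (map (lower_coord l i) (sorted_list_of_set T)) = lower_coord l i ` T"
      using diagonal_finite[OF T] by simp
    ultimately show ?thesis by metis
  qed
  \<comment> \<open>By \<open>lower_coord_fiber\<close> only \<open>P\<close> and \<open>?Q\<close>
    can contribute at \<open>?R\<close>, and \<open>u\<close> has coefficient 0 at \<open>P\<close>.
    The remaining term is nonzero, which is the contradiction.\<close>
  have "0 = coeff (gl_act d k (raising l i) (\<Sum>T | coeff u T \<noteq> 0. scale (coeff u T) (psi T))) ?R"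
    using raise by (simp add: exterior_expand[of u, symmetric])
  also have "\<dots> = (\<Sum>T | coeff u T \<noteq> 0. coeff u T * coeff (gl_act d k (raising l i) (psi T)) ?R)"
    by (simp add: gl_act_sum gl_act_scale)
  also have "\<dots> = (\<Sum>T | coeff u T \<noteq> 0.
      if T = ?Q then coeff u ?Q * coeff (gl_act d k (raising l i) (psi ?Q)) ?R else 0)"
  proof (intro sum.cong refl)
    fix T assume "T \<in> {T. coeff u T \<noteq> 0}"
    then have T: "coeff u T \<noteq> 0" "diagonal d k T" using supp by auto
    have "coeff (gl_act d k (raising l i) (psi T)) ?R = 0" if "T \<noteq> ?Q"
    proof (rule ccontr)
      assume "coeff (gl_act d k (raising l i) (psi T)) ?R \<noteq> 0"
      then have "lower_coord l i ` T = lower_coord l i ` P" using psi[OF T(2)] R by simp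
      then have "T = P" using lower_coord_fiber[OF d0 P(1) T(2) l i] that by simp
      then show False using T zero by simp
    qed
    then show "coeff u T * coeff (gl_act d k (raising l i) (psi T)) ?R =
      (if T = ?Q then coeff u ?Q * coeff (gl_act d k (raising l i) (psi ?Q)) ?R else 0)" by auto
  qed
  also have "\<dots> = coeff u ?Q * coeff (gl_act d k (raising l i) (psi ?Q)) ?R"
    using Q by (simp add: coeff_finite_support)
  finally show False using Q psi[OF P(2)] by simp
qed

text \<open>Vanishing spreads from the main diagonal by \<open>raise_zero_swap\<close>: each
  exchange of neighbouring values in one direction leads to another diagonal, and such exchanges
  reach all of them.\<close>

lemma raise_zero_unique:
  assumes d: "2 \<le> d" and k: "0 < k" and supp: "\<And>T. coeff u T \<noteq> 0 \<Longrightarrow> diagonal d k T"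
    and raise: "\<And>l i. l < d \<Longrightarrow> 1 \<le> i \<Longrightarrow> i < k \<Longrightarrow> gl_act d k (raising l i) u = 0"
    and zero: "coeff u (diag_cell d (\<lambda>_. id) ` {1..k}) = 0"
  shows "u = 0"
proof -
  let ?D = "\<lambda>p. diag_cell d p ` {1..k}"
  have d0: "0 < d" using d by simp
  have step: "coeff u (?D (p(l := transpose i (i + 1) \<circ> p l))) = 0"
    if "perm_tuple d k p" "l < d" "1 \<le> i" "i < k" "coeff u (?D p) = 0" for p l i
  proof -
    let ?q = "p(l := transpose i (i + 1) \<circ> p l)"
    have "transpose i (i + 1) permutes {1..k}" using that by (intro permutes_swap_id) auto
    then have "perm_tuple d k ?q" using that(1,2) permutes_compose by (auto simp: perm_tuple_def)
    moreover have "?D ?q = swap_coord l i ` ?D p"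
      using swap_coord_diag_cell[OF that(2), of i p] by (simp add: image_image)
    ultimately show ?thesis
      using raise_zero_swap[OF d supp diagonal_diag_cell[OF d0 k that(1)] _ that(2-4) raise[OF that(2-4)] that(5)]
        diagonal_diag_cell[OF d0 k, of ?q] by simp
  qed
  \<comment> \<open>The number \<open>m\<close> bounds the directions in which \<open>p\<close> may
    differ from \<open>id\<close>. The induction step builds the permutation in direction
    \<open>m\<close> from adjacent transpositions.\<close>
  have "coeff u (?D p) = 0" if "perm_tuple d k p" "\<forall>l<d. m \<le> l \<longrightarrow> p l = id" "m \<le> d" for p m
    using that
  proof (induction m arbitrary: p)
    case 0
    then have "diag_cell d p = diag_cell d (\<lambda>_. id)" by (auto simp: diag_cell_def fun_eq_iff)
    then show ?case using zero by simp
  next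
    case (Suc m)
    have tuple: "perm_tuple d k (p(m := \<sigma>))" if "\<sigma> permutes {1..k}" for \<sigma>
      using that Suc.prems(1) by (simp add: perm_tuple_def)
    have "p m permutes {1..k}" using Suc.prems by (simp add: perm_tuple_def)
    then have "coeff u (?D (p(m := p m))) = 0"
    proof (induction rule: permutes_adjacent_induct)
      case id
      show ?case
      proof (rule Suc.IH)
        show "perm_tuple d k (p(m := id))" by (rule tuple[OF permutes_id])
        show "\<forall>l<d. m \<le> l \<longrightarrow> (p(m := id)) l = id"
          using Suc.prems(2) by (metis Suc_leI fun_upd_apply le_neq_implies_less)
      qed (use Suc.prems in simp)
    next
      case (swap i \<sigma>)
      have "coeff u (?D ((p(m := \<sigma>))(m := transpose i (i + 1) \<circ> (p(m := \<sigma>)) m))) = 0"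
        by (rule step[OF tuple[OF swap(3)] _ swap(1,2,4)]) (use Suc.prems in simp)
      then show ?case by (simp only: fun_upd_upd fun_upd_same)
    qed
    then show ?case by simp
  qed
  from this[of _ d] have all: "coeff u (?D p) = 0" if "perm_tuple d k p" for p using that by auto
  show ?thesis
  proof (rule exterior_eqI)
    fix T
    show "coeff u T = coeff 0 T"
    proof (rule ccontr)
      assume "coeff u T \<noteq> coeff 0 T"
      then have "diagonal d k T" using supp by simp
      then obtain p where "perm_tuple d k p" "T = ?D p" using diagonal_obtain[OF d0 k] by blast
      then show False using all \<open>coeff u T \<noteq> coeff 0 T\<close> by simp
    qed
  qed
qed

lemma coeff_omega_main_diagonal:
  assumes "0 < d" "0 < k"
  shows "coeff (omega d k) (diag_cell d (\<lambda>_. id) ` {1..k}) = 1"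
proof -
  have "perm_tuple d k (\<lambda>_. id)" by (simp add: perm_tuple_def)
  then show ?thesis
    using assms diagonal_diag_cell[OF assms, of "\<lambda>_. id"] set_sign_diag_cell[OF assms(1), of "\<lambda>_. id" k]
    by (simp add: coeff_omega)
qed

lemma omega_highest_weight_vector:
  assumes "odd d" "0 < k"
  shows "highest_weight_vector d k 1 (omega d k)"
proof -
  have d: "0 < d" using assms by (auto intro: Nat.gr0I)
  have "omega d k \<in> magic_space d k 1"
    unfolding magic_space_1_iff by (simp add: coeff_omega[OF d assms(2)])
  moreover have "omega d k \<noteq> 0"
    using coeff_omega_main_diagonal[OF d assms(2)] by auto
  ultimately show ?thesis
    using raise_omega[OF assms(1)] by (simp add: highest_weight_vector_def)
qed

lemma highest_weight_vector_unique:
  assumes d: "2 \<le> d" "odd d" and k: "0 < k" and v: "highest_weight_vector d k 1 v"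
  shows "\<exists>c. v = scale c (omega d k)"
proof -
  let ?T = "diag_cell d (\<lambda>_. id) ` {1..k}"
  let ?c = "coeff v ?T"
  have d0: "0 < d" using d by simp
  \<comment> \<open>The scalar is chosen so that the difference vanishes at the main diagonal, where
    \<open>omega\<close> has coefficient 1.\<close>
  have "v + scale (- ?c) (omega d k) = 0"
  proof (rule raise_zero_unique[OF d(1) k])
    fix T assume "coeff (v + scale (- ?c) (omega d k)) T \<noteq> 0"
    then have "coeff v T \<noteq> 0 \<or> coeff (omega d k) T \<noteq> 0" by auto
    moreover have "v \<in> magic_space d k 1" using v by (simp only: highest_weight_vector_def)
    then have "coeff v T \<noteq> 0 \<longrightarrow> diagonal d k T" unfolding magic_space_1_iff by blast
    ultimately show "diagonal d k T"
      using coeff_omega[OF d0 k, of T] by (auto split: if_splits)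
  next
    fix l i assume "l < d" "1 \<le> i" "i < k"
    then have "gl_act d k (raising l i) v = 0" "gl_act d k (raising l i) (omega d k) = 0"
      using v raise_omega[OF d(2)] by (simp_all add: highest_weight_vector_def)
    then show "gl_act d k (raising l i) (v + scale (- ?c) (omega d k)) = 0"
      by (simp only: gl_act_add gl_act_scale exterior.scale_zero_right add_0)
  next
    show "coeff (v + scale (- ?c) (omega d k)) ?T = 0"
      using coeff_omega_main_diagonal[OF d0 k] by simp
  qed
  then have "v = scale ?c (omega d k)" by (simp add: add_eq_0_iff)
  then show ?thesis by blast
qed

section \<open>The odd case\<close>

lemma gen_mult_prod_list:
  "gen x * prod_list (map gen ys) = scale ((- 1) ^ length ys) (prod_list (map gen ys) * gen x)"
proof (induction ys)
  case (Cons y ys)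
  have "gen x * prod_list (map gen (y # ys)) = (gen x * gen y) * prod_list (map gen ys)"
    by (simp add: mult.assoc)
  also have "\<dots> = - (gen y * (gen x * prod_list (map gen ys)))"
    unfolding gen_anticommute[of x] by (simp add: mult.assoc)
  also have "\<dots> = scale ((- 1) ^ length (y # ys)) (prod_list (map gen (y # ys)) * gen x)"
    by (simp add: Cons.IH mult.assoc)
  finally show ?case .
qed simp

lemma prod_list_gen_commute:
  "prod_list (map gen xs) * prod_list (map gen ys) =
    scale ((- 1) ^ (length xs * length ys)) (prod_list (map gen ys) * prod_list (map gen xs))"
proof (induction xs)
  case (Cons x xs)
  have "prod_list (map gen (x # xs)) * prod_list (map gen ys) =
      gen x * (prod_list (map gen xs) * prod_list (map gen ys))"
    by (simp add: mult.assoc)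
  also have "\<dots> = scale ((- 1) ^ (length xs * length ys))
      ((gen x * prod_list (map gen ys)) * prod_list (map gen xs))"
    by (simp add: Cons.IH mult.assoc)
  also have "\<dots> = scale ((- 1) ^ (length (x # xs) * length ys))
      (prod_list (map gen ys) * prod_list (map gen (x # xs)))"
    unfolding gen_mult_prod_list by (simp add: mult.assoc power_add mult.commute)
  finally show ?case .
qed simp

text \<open>Moving \<open>k\<close> factors past \<open>k\<close> others produces the sign of
  \<open>k * k\<close> exchanges, an odd number.\<close>

lemma wedge_odd_anticommute:
  assumes "odd k"
  shows "wedge k g * wedge k h = - (wedge k h * wedge k g)"
  using prod_list_gen_commute[of "map g [1..<k + 1]" "map h [1..<k + 1]"] assms
  unfolding wedge_eq by (simp del: upt_Suc map_map)

text \<open>Expanding the square as a double sum and exchanging the two summation indices shows that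
  it equals its own negative.\<close>

lemma omega_square_zero:
  assumes "0 < d" "odd k"
  shows "omega d k * omega d k = 0"
proof (rule exterior_eq_neg_zero)
  let ?c = "\<lambda>p. of_int (\<Prod>l\<in>{1..<d}. sign (p l)) :: complex"
  let ?w = "\<lambda>p. wedge k (diag_cell d (p(0 := id)))"
  let ?I = "omega_index d k"
  have "omega d k * omega d k = (\<Sum>p\<in>?I. \<Sum>q\<in>?I. scale (?c p) (?w p) * scale (?c q) (?w q))"
    unfolding omega_eq_wedges[OF assms(1)] by (rule sum_product)
  also have "\<dots> = (\<Sum>p\<in>?I. \<Sum>q\<in>?I. - (scale (?c q) (?w q) * scale (?c p) (?w p)))"
  proof (intro sum.cong refl)
    fix p q
    show "scale (?c p) (?w p) * scale (?c q) (?w q) = - (scale (?c q) (?w q) * scale (?c p) (?w p))"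
      using wedge_odd_anticommute[OF assms(2), of "diag_cell d (p(0 := id))" "diag_cell d (q(0 := id))"]
      by (simp add: mult.commute del: of_int_prod)
  qed
  also have "\<dots> = - (\<Sum>q\<in>?I. \<Sum>p\<in>?I. scale (?c q) (?w q) * scale (?c p) (?w p))"
    by (subst sum.swap) (simp only: sum_negf)
  also have "\<dots> = - (omega d k * omega d k)"
    unfolding omega_eq_wedges[OF assms(1)] sum_product ..
  finally show "omega d k * omega d k = - (omega d k * omega d k)" .
qed

theorem theorem8p4:
  fixes d k :: nat
  assumes "d \<ge> 3" and "odd d" and "k \<ge> 1"
  shows
    "(highest_weight_vector d k 1 (omega d k) \<and>
      (\<forall>v. highest_weight_vector d k 1 v \<longrightarrow> (\<exists>c. v = scale c (omega d k)))) \<and>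
     (even k \<longrightarrow>
      (\<forall>n. 1 \<le> n \<and> n \<le> k ^ (d - 1) \<longrightarrow>
        (\<exists>\<epsilon>\<in>{1, - 1 :: complex}. omega d k ^ n =
          scale \<epsilon> (\<Sum>T | magic d k T \<and> card T = n * k.
            scale (of_int (set_sign d T * AT_type d k T)) (psi T)))) \<and>
      (\<exists>\<epsilon>\<in>{1, - 1 :: complex}. omega d k ^ (k ^ (d - 1)) =
        scale \<epsilon> (scale (of_int (AT d k)) (psi (cells d k))))) \<and>
     (odd k \<longrightarrow> omega d k * omega d k = 0)"
proof (intro conjI impI allI)
  have d: "0 < d" "2 \<le> d" and k: "0 < k" using assms by simp_all
  have sign: "of_int s \<in> {1, - 1 :: complex}" if "s * s = 1" for s :: int
    using that by (auto simp: square_eq_1_iff)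
  show "highest_weight_vector d k 1 (omega d k)"
    by (rule omega_highest_weight_vector[OF assms(2) k])
  show "\<exists>c. v = scale c (omega d k)" if "highest_weight_vector d k 1 v" for v
    by (rule highest_weight_vector_unique[OF d(2) assms(2) k that])
  \<comment> \<open>The sign is the grid sign of \<open>{1..k}\<close> and \<open>{1..n}\<close>, so
    it depends only on \<open>k\<close> and \<open>n\<close> and is the same for every
    \<open>T\<close>.\<close>
  show "\<exists>\<epsilon>\<in>{1, - 1 :: complex}. omega d k ^ n =
      scale \<epsilon> (\<Sum>T | magic d k T \<and> card T = n * k.
        scale (of_int (set_sign d T * AT_type d k T)) (psi T))" for n
    by (rule bexI, rule omega_power_eq[OF assms(2) k], rule sign) simp
  \<comment> \<open>For the full cube the sum has a single term, and its \<open>set_sign\<close> is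
    absorbed into the sign in front.\<close>
  have "set_sign d (cells d k) * set_sign d (cells d k) = 1"
    by (simp add: set_sign_eq finite_cells prod.distrib[symmetric])
  then have s: "(grid_sign {1..k} {1..k ^ (d - 1)} * set_sign d (cells d k)) *
      (grid_sign {1..k} {1..k ^ (d - 1)} * set_sign d (cells d k)) = 1"
    using grid_sign_squared[of "{1..k}" "{1..k ^ (d - 1)}"]
    by (metis mult.assoc mult.left_commute mult_1_right)
  show "\<exists>\<epsilon>\<in>{1, - 1 :: complex}. omega d k ^ (k ^ (d - 1)) =
      scale \<epsilon> (scale (of_int (AT d k)) (psi (cells d k)))"
    by (rule bexI, rule omega_full_power[OF assms(2) k], rule sign[OF s])
  show "omega d k * omega d k = 0" if "odd k"
    by (rule omega_square_zero[OF d(1) that])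
qed

end
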